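(* The composite functor $\hat{H}\Pi\colon\mathsf{sMat}_\ast\to\mathsf{Mod}_{\mathbb{F}_1}$ from simple pointed matroids to $\mathbb{F}_1$-modules is faithful, and its restriction to the full subcategory $\mathsf{Proj}\subseteq\mathsf{sMat}_\ast$ of projective geometries is fully faithful.
   Context: Matroids. A matroid is a set $M$ with a function $\kappa\colon\mathcal{P}(M)\to\mathcal{P}(M)$ ($\mathcal{P}$ denotes power set) such that for all $A,B\subseteq M$ and $x,y\in M$: $A\subseteq\kappa(A)$; $A\subseteq B$ implies $\kappa(A)\subseteq\kappa(B)$; $\kappa(\kappa(A))=\kappa(A)$; if $x\in\kappa(A\cup\{y\})$ and $x\notin\kappa(A)$ then $y\in\kappa(A\cup\{x\})$. A morphism $(M,\kappa)\to(N,\kappa')$ is a function $f\colon M\to N$ with $f(\kappa(A))\subseteq\kappa'(f(A))$ for all $A\subseteq M$. A pointed matroid $(M,\kappa,0)$ has a distinguished element $0\in\kappa(\varnothing)$; it is simple if $\kappa(\varnothing)=\{0\}$ and $\kappa(\{x\})=\{0,x\}$ for all $x\in M$. $\mathsf{sMat}_\ast$ is the category of simple pointed matroids and matroid morphisms preserving the base point. A projective geometry is a simple pointed matroid such that for all $A,B\subseteq M$: $\kappa(A)=\bigcup\{\kappa(B'):B'\subseteq A\text{ finite}\}$ and $\kappa(A\cup B)=\bigcup\{\kappa(\{x,y\}):x\in\kappa(A),\,y\in\kappa(B)\}$. $\mathsf{Proj}$ is the full subcategory of $\mathsf{sMat}_\ast$ on these. Plasmas. A plasma is a triple $(M,\boxplus,e)$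 with $M$ a set, $\boxplus\colon M\times M\to\mathcal{P}(M)$ a function and $e\in M$, such that $a\in e\boxplus a$ for all $a\in M$ and $a\boxplus b=b\boxplus a$ for all $a,b\in M$. A morphism $(M,\boxplus,e)\to(M',\star,e')$ is a function $f$ with $f(e)=e'$ and $f(a\boxplus b)\subseteq f(a)\star f(b)$. These form the category $\mathsf{Plas}$. The functor $\Pi\colon\mathsf{sMat}_\ast\to\mathsf{Plas}$ sends $(M,\kappa,0)$ to the plasma $(M,\boxplus_\kappa,0)$ where $x\boxplus_\kappa y=\kappa(\{x,y\})\setminus\{x,y,0\}$ if $x\ne y$ are both nonzero, $x\boxplus_\kappa x=\{x,0\}$, and $x\boxplus_\kappa 0=0\boxplus_\kappa x=\{x\}$; it is the identity on underlying functions of morphisms. $\mathbb{F}_1$-modules. $\mathsf{Fin}_\ast$ is the category whose objects are the pointed sets $\langle n\rangle=\{0,1,\ldots,n\}$, $n\ge 0$, with basepoint $0$, and whose morphisms are pointed functions. An $\mathbb{F}_1$-module is a functor $X\colon\mathsf{Fin}_\ast\to\mathsf{Set}_\ast$ to pointed sets such that $X(\langle 0\rangle)$ is a singleton; $\mathsf{Mod}_{\mathbb{F}_1}$ is the category of these and natural transformations. The functor $\hat{H}\colon\mathsf{Plas}\to\mathsf{Mod}_{\mathbb{F}_1}$. Write $[n]=\{1,\ldots,n\}$. For a plasma $(M,\boxplus,0)$, $$\hat{H}M_n=\{(x_S)_{S\subseteq[n]}: x_S\in M,\ x_\varnothing=0,\ x_{S\cup T}\in x_S\boxplus x_T\text{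 whenever }S\cap T=\varnothing\},$$ pointed by the constant family $0$. A morphism $\phi\colon\langle n\rangle\to\langle m\rangle$ acts by $(x_S)_{S\subseteq[n]}\mapsto (x_{\phi^{-1}(T)})_{T\subseteq[m]}$. A plasma morphism $f$ induces $(x_S)_S\mapsto (f(x_S))_S$. *)

theory Defs
  imports Main "HOL-Library.FuncSet"
begin

record ('o, 'm) category =
  obj :: "'o set"
  arr :: "'m set"
  src :: "'m \<Rightarrow> 'o"
  tgt :: "'m \<Rightarrow> 'o"
  ident :: "'o \<Rightarrow> 'm"
  cmp :: "'m \<Rightarrow> 'm \<Rightarrow> 'm"  \<comment> \<open>\<open>cmp C g f\<close> is \<open>g\<close> after \<open>f\<close>\<close>

definition hom :: "('o, 'm) category \<Rightarrow> 'o \<Rightarrow> 'o \<Rightarrow> 'm set" where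
  "hom C a b = {f \<in> arr C. src C f = a \<and> tgt C f = b}"

definition is_category :: "('o, 'm) category \<Rightarrow> bool" where
  "is_category C \<longleftrightarrow>
     (\<forall>f \<in> arr C. src C f \<in> obj C \<and> tgt C f \<in> obj C) \<and>
     (\<forall>a \<in> obj C. ident C a \<in> hom C a a) \<and>
     (\<forall>a b c. \<forall>f \<in> hom C a b. \<forall>g \<in> hom C b c. cmp C g f \<in> hom C a c) \<and>
     (\<forall>a b. \<forall>f \<in> hom C a b. cmp C f (ident C a) = f \<and> cmp C (ident C b) f = f) \<and>
     (\<forall>a b c d. \<forall>f \<in> hom C a b. \<forall>g \<in> hom C b c. \<forall>h \<in> hom C c d.
        cmp C h (cmp C g f) = cmp C (cmp C h g) f)"

definition full_subcategory :: "('o, 'm) category \<Rightarrow> ('o \<Rightarrow> bool) \<Rightarrow> ('o, 'm) category" where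
  "full_subcategory C P =
     C\<lparr>obj := {a \<in> obj C. P a}, arr := {f \<in> arr C. P (src C f) \<and> P (tgt C f)}\<rparr>"

record ('o, 'm, 'p, 'n) ftor =
  omap :: "'o \<Rightarrow> 'p"
  amap :: "'m \<Rightarrow> 'n"

text \<open>Maps with a prescribed domain are required to be \<^const>\<open>extensional\<close>, here and below, so that
  equality in HOL is equality of the mathematical objects.\<close>

definition is_functor ::
  "('o, 'm) category \<Rightarrow> ('p, 'n) category \<Rightarrow> ('o, 'm, 'p, 'n) ftor \<Rightarrow> bool" where
  "is_functor C D F \<longleftrightarrow>
     is_category C \<and> is_category D \<and>
     omap F \<in> obj C \<rightarrow>\<^sub>E obj D \<and> amap F \<in> arr C \<rightarrow>\<^sub>E arr D \<and>
     (\<forall>f \<in> arr C. src D (amap F f) = omap F (src C f) \<and> tgt D (amap F f) = omap F (tgt C f)) \<and>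
     (\<forall>a \<in> obj C. amap F (ident C a) = ident D (omap F a)) \<and>
     (\<forall>f \<in> arr C. \<forall>g \<in> arr C. tgt C f = src C g \<longrightarrow>
        amap F (cmp C g f) = cmp D (amap F g) (amap F f))"

definition comp_functor ::
  "('o, 'm) category \<Rightarrow> ('p, 'n, 'q, 'k) ftor \<Rightarrow> ('o, 'm, 'p, 'n) ftor \<Rightarrow> ('o, 'm, 'q, 'k) ftor" where
  "comp_functor C G F =
     \<lparr>omap = compose (obj C) (omap G) (omap F), amap = compose (arr C) (amap G) (amap F)\<rparr>"

definition restrict_functor ::
  "('o, 'm, 'p, 'n) ftor \<Rightarrow> ('o, 'm) category \<Rightarrow> ('o, 'm, 'p, 'n) ftor" where
  "restrict_functor F C = \<lparr>omap = restrict (omap F) (obj C), amap = restrict (amap F) (arr C)\<rparr>"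

definition faithful_functor ::
  "('o, 'm) category \<Rightarrow> ('p, 'n) category \<Rightarrow> ('o, 'm, 'p, 'n) ftor \<Rightarrow> bool" where
  "faithful_functor C D F \<longleftrightarrow>
     is_functor C D F \<and> (\<forall>a \<in> obj C. \<forall>b \<in> obj C. inj_on (amap F) (hom C a b))"

definition full_functor ::
  "('o, 'm) category \<Rightarrow> ('p, 'n) category \<Rightarrow> ('o, 'm, 'p, 'n) ftor \<Rightarrow> bool" where
  "full_functor C D F \<longleftrightarrow>
     is_functor C D F \<and>
     (\<forall>a \<in> obj C. \<forall>b \<in> obj C. amap F ` hom C a b = hom D (omap F a) (omap F b))"

definition fully_faithful_functor ::
  "('o, 'm) category \<Rightarrow> ('p, 'n) category \<Rightarrow> ('o, 'm, 'p, 'n) ftor \<Rightarrow> bool" where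
  "fully_faithful_functor C D F \<longleftrightarrow> full_functor C D F \<and> faithful_functor C D F"

definition natural_transformation ::
  "('o, 'm) category \<Rightarrow> ('p, 'n) category \<Rightarrow>
     ('o, 'm, 'p, 'n) ftor \<Rightarrow> ('o, 'm, 'p, 'n) ftor \<Rightarrow> ('o \<Rightarrow> 'n) \<Rightarrow> bool" where
  "natural_transformation C D F G \<eta> \<longleftrightarrow>
     is_functor C D F \<and> is_functor C D G \<and> \<eta> \<in> extensional (obj C) \<and>
     (\<forall>a \<in> obj C. \<eta> a \<in> hom D (omap F a) (omap G a)) \<and>
     (\<forall>f \<in> arr C. cmp D (\<eta> (tgt C f)) (amap F f) = cmp D (amap G f) (\<eta> (src C f)))"

datatype ('o, 'f) arrow = Arrow (source: 'o) (target: 'o) (mapping: 'f)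

definition functor_category ::
  "('o, 'm) category \<Rightarrow> ('p, 'n) category \<Rightarrow>
     (('o, 'm, 'p, 'n) ftor, (('o, 'm, 'p, 'n) ftor, 'o \<Rightarrow> 'n) arrow) category" where
  "functor_category C D =
     \<lparr>obj = {F. is_functor C D F},
      arr = {Arrow F G \<eta> | F G \<eta>. natural_transformation C D F G \<eta>},
      src = source, tgt = target,
      ident = (\<lambda>F. Arrow F F (\<lambda>a \<in> obj C. ident D (omap F a))),
      cmp = (\<lambda>\<beta> \<alpha>. Arrow (source \<alpha>) (target \<beta>)
                      (\<lambda>a \<in> obj C. cmp D (mapping \<beta> a) (mapping \<alpha> a)))\<rparr>"

text \<open>A category of structured sets: objects \<open>X \<in> Ob\<close> with underlying set \<open>U X\<close>, arrows the
  functions in \<open>Mor X Y\<close>.\<close>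

definition concrete_category ::
  "'o set \<Rightarrow> ('o \<Rightarrow> 'a set) \<Rightarrow> ('o \<Rightarrow> 'o \<Rightarrow> ('a \<Rightarrow> 'a) set) \<Rightarrow>
     ('o, ('o, 'a \<Rightarrow> 'a) arrow) category" where
  "concrete_category Ob U Mor =
     \<lparr>obj = Ob,
      arr = {Arrow X Y f | X Y f. X \<in> Ob \<and> Y \<in> Ob \<and> f \<in> Mor X Y},
      src = source, tgt = target,
      ident = (\<lambda>X. Arrow X X (\<lambda>x \<in> U X. x)),
      cmp = (\<lambda>g f. Arrow (source f) (target g)
                     (compose (U (source f)) (mapping g) (mapping f)))\<rparr>"

record 'a matroid =
  ground :: "'a set"
  cl :: "'a set \<Rightarrow> 'a set"

record 'a pointed_matroid = "'a matroid" +
  mpt :: 'a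

definition is_matroid :: "('a, 'z) matroid_scheme \<Rightarrow> bool" where
  "is_matroid M \<longleftrightarrow>
     cl M \<in> Pow (ground M) \<rightarrow>\<^sub>E Pow (ground M) \<and>
     (\<forall>A. A \<subseteq> ground M \<longrightarrow> A \<subseteq> cl M A) \<and>
     (\<forall>A B. A \<subseteq> B \<and> B \<subseteq> ground M \<longrightarrow> cl M A \<subseteq> cl M B) \<and>
     (\<forall>A. A \<subseteq> ground M \<longrightarrow> cl M (cl M A) = cl M A) \<and>
     (\<forall>A. A \<subseteq> ground M \<longrightarrow> (\<forall>x \<in> ground M. \<forall>y \<in> ground M.
        x \<in> cl M (A \<union> {y}) \<and> x \<notin> cl M A \<longrightarrow> y \<in> cl M (A \<union> {x})))"

definition matroid_morphisms ::
  "('a, 'y) matroid_scheme \<Rightarrow> ('b, 'z) matroid_scheme \<Rightarrow> ('a \<Rightarrow> 'b) set" where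
  "matroid_morphisms M N =
     {f \<in> ground M \<rightarrow>\<^sub>E ground N. \<forall>A. A \<subseteq> ground M \<longrightarrow> f ` cl M A \<subseteq> cl N (f ` A)}"

definition is_pointed_matroid :: "'a pointed_matroid \<Rightarrow> bool" where
  "is_pointed_matroid M \<longleftrightarrow> is_matroid M \<and> mpt M \<in> cl M {}"

definition is_simple :: "'a pointed_matroid \<Rightarrow> bool" where
  "is_simple M \<longleftrightarrow> cl M {} = {mpt M} \<and> (\<forall>x \<in> ground M. cl M {x} = {mpt M, x})"

definition pointed_matroid_morphisms ::
  "'a pointed_matroid \<Rightarrow> 'b pointed_matroid \<Rightarrow> ('a \<Rightarrow> 'b) set" where
  "pointed_matroid_morphisms M N = {f \<in> matroid_morphisms M N. f (mpt M) = mpt N}"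

definition sMat ::
  "('a pointed_matroid, ('a pointed_matroid, 'a \<Rightarrow> 'a) arrow) category" where
  "sMat = concrete_category {M. is_pointed_matroid M \<and> is_simple M} ground
            pointed_matroid_morphisms"

definition is_projective_geometry :: "'a pointed_matroid \<Rightarrow> bool" where
  "is_projective_geometry M \<longleftrightarrow>
     is_pointed_matroid M \<and> is_simple M \<and>
     (\<forall>A. A \<subseteq> ground M \<longrightarrow> cl M A = \<Union> {cl M B | B. B \<subseteq> A \<and> finite B}) \<and>
     (\<forall>A B. A \<subseteq> ground M \<and> B \<subseteq> ground M \<longrightarrow>
        cl M (A \<union> B) = \<Union> {cl M {x, y} | x y. x \<in> cl M A \<and> y \<in> cl M B})"

definition Proj ::
  "('a pointed_matroid, ('a pointed_matroid, 'a \<Rightarrow> 'a) arrow) category" where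
  "Proj = full_subcategory sMat is_projective_geometry"

record 'a plasma =
  elts :: "'a set"
  padd :: "'a \<Rightarrow> 'a \<Rightarrow> 'a set"
  pzero :: 'a

definition is_plasma :: "'a plasma \<Rightarrow> bool" where
  "is_plasma M \<longleftrightarrow>
     padd M \<in> elts M \<rightarrow>\<^sub>E elts M \<rightarrow>\<^sub>E Pow (elts M) \<and>
     pzero M \<in> elts M \<and>
     (\<forall>a \<in> elts M. a \<in> padd M (pzero M) a) \<and>
     (\<forall>a \<in> elts M. \<forall>b \<in> elts M. padd M a b = padd M b a)"

definition plasma_morphisms :: "'a plasma \<Rightarrow> 'b plasma \<Rightarrow> ('a \<Rightarrow> 'b) set" where
  "plasma_morphisms M N =
     {f \<in> elts M \<rightarrow>\<^sub>E elts N. f (pzero M) = pzero N \<and>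
        (\<forall>a \<in> elts M. \<forall>b \<in> elts M. f ` padd M a b \<subseteq> padd N (f a) (f b))}"

definition Plas :: "('a plasma, ('a plasma, 'a \<Rightarrow> 'a) arrow) category" where
  "Plas = concrete_category {M. is_plasma M} elts plasma_morphisms"

definition matroid_plasma :: "'a pointed_matroid \<Rightarrow> 'a plasma" where
  "matroid_plasma M =
     \<lparr>elts = ground M,
      padd = (\<lambda>x \<in> ground M. \<lambda>y \<in> ground M.
        if x = mpt M then {y}
        else if y = mpt M then {x}
        else if x = y then {x, mpt M}
        else cl M {x, y} - {x, y, mpt M}),
      pzero = mpt M\<rparr>"

definition Pi_functor ::
  "('a pointed_matroid, ('a pointed_matroid, 'a \<Rightarrow> 'a) arrow,
    'a plasma, ('a plasma, 'a \<Rightarrow> 'a) arrow) ftor" where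
  "Pi_functor =
     \<lparr>omap = (\<lambda>M \<in> obj sMat. matroid_plasma M),
      amap = (\<lambda>f \<in> arr sMat.
        Arrow (matroid_plasma (source f)) (matroid_plasma (target f)) (mapping f))\<rparr>"

record 'a pset =
  pcarrier :: "'a set"
  base :: 'a

definition Set_pt :: "('a pset, ('a pset, 'a \<Rightarrow> 'a) arrow) category" where
  "Set_pt = concrete_category {X. base X \<in> pcarrier X} pcarrier
     (\<lambda>X Y. {f \<in> pcarrier X \<rightarrow>\<^sub>E pcarrier Y. f (base X) = base Y})"

text \<open>The object \<open>n\<close> stands for the set \<open>{0, \<dots>, n}\<close> with base point \<open>0\<close>.\<close>

definition Fin_pt :: "(nat, (nat, nat \<Rightarrow> nat) arrow) category" where
  "Fin_pt = concrete_category UNIV (\<lambda>n. {0..n})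
     (\<lambda>n m. {\<phi> \<in> {0..n} \<rightarrow>\<^sub>E {0..m}. \<phi> 0 = 0})"

type_synonym 'a F1_functor =
  "(nat, (nat, nat \<Rightarrow> nat) arrow, 'a pset, ('a pset, 'a \<Rightarrow> 'a) arrow) ftor"

type_synonym 'a F1_arrow =
  "('a F1_functor, nat \<Rightarrow> ('a pset, 'a \<Rightarrow> 'a) arrow) arrow"

definition Mod_F1 :: "('a F1_functor, 'a F1_arrow) category" where
  "Mod_F1 = full_subcategory (functor_category Fin_pt Set_pt)
     (\<lambda>X. is_singleton (pcarrier (omap X 0)))"

definition Hhat_set :: "'a plasma \<Rightarrow> nat \<Rightarrow> (nat set \<Rightarrow> 'a) set" where
  "Hhat_set M n =
     {x \<in> Pow {1..n} \<rightarrow>\<^sub>E elts M. x {} = pzero M \<and>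
        (\<forall>S T. S \<subseteq> {1..n} \<and> T \<subseteq> {1..n} \<and> S \<inter> T = {} \<longrightarrow> x (S \<union> T) \<in> padd M (x S) (x T))}"

definition Hhat_pset :: "'a plasma \<Rightarrow> nat \<Rightarrow> (nat set \<Rightarrow> 'a) pset" where
  "Hhat_pset M n = \<lparr>pcarrier = Hhat_set M n, base = (\<lambda>S \<in> Pow {1..n}. pzero M)\<rparr>"

definition Hhat_module :: "'a plasma \<Rightarrow> (nat set \<Rightarrow> 'a) F1_functor" where
  "Hhat_module M =
     \<lparr>omap = Hhat_pset M,
      amap = (\<lambda>\<phi> \<in> arr Fin_pt.
        Arrow (Hhat_pset M (source \<phi>)) (Hhat_pset M (target \<phi>))
          (\<lambda>x \<in> Hhat_set M (source \<phi>). \<lambda>T \<in> Pow {1..target \<phi>}.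
             x {i \<in> {0..source \<phi>}. mapping \<phi> i \<in> T}))\<rparr>"

definition Hhat_functor ::
  "('a plasma, ('a plasma, 'a \<Rightarrow> 'a) arrow,
    (nat set \<Rightarrow> 'a) F1_functor, (nat set \<Rightarrow> 'a) F1_arrow) ftor" where
  "Hhat_functor =
     \<lparr>omap = (\<lambda>M \<in> obj Plas. Hhat_module M),
      amap = (\<lambda>f \<in> arr Plas.
        Arrow (Hhat_module (source f)) (Hhat_module (target f))
          (\<lambda>n. Arrow (Hhat_pset (source f) n) (Hhat_pset (target f) n)
             (\<lambda>x \<in> Hhat_set (source f) n. \<lambda>S \<in> Pow {1..n}. mapping f (x S))))\<rparr>"

end

theory Submission
  imports Defs
begin

text \<open>
  The composite is studied one factor at a time, since faithfulness and fullness pass to composites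
  (\<open>faithful_comp_functor\<close>, \<open>full_comp_functor\<close>).

  \<^bold>\<open>The module of a plasma loses nothing.\<close>  The functor from plasmas to modules is fully faithful on
  \<^emph>\<open>all\<close> plasmas.  A family in degree 1 is just an element of \<open>M\<close> (\<open>point_family\<close>), so a plasma
  morphism can be read off in degree 1, and any natural transformation determines a function \<open>f\<close>
  there.  The entry \<open>x S\<close> of a family \<open>x\<close> in degree \<open>n\<close> is its image in degree 1 under the indicator
  map of \<open>S\<close>, so naturality makes \<open>f\<close> determine the transformation in every degree.  Finally a
  relation \<open>z \<in> x \<boxplus> y\<close> is the same thing as a family in degree 2 with entries \<open>x\<close>, \<open>y\<close>, \<open>z\<close>
  (\<open>sum_family\<close>); the transformation maps it to such a family again, so \<open>f\<close> preserves these relations.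
  This is \<open>natural_transformation_is_Hhat_component\<close>.

  \<^bold>\<open>The plasma of a matroid.\<close>  The functor \<open>\<Pi>\<close> does not change underlying functions, so once it is
  known to be well defined it is faithful for free.  That a matroid morphism respects \<open>\<boxplus>\<close> is an
  exchange argument: if \<open>z\<close> is a third point of the line through \<open>x\<close> and \<open>y\<close>, then each of the three
  points lies in the closure of the other two, and the images inherit these three relations.

  \<^bold>\<open>Fullness on projective geometries.\<close>  A plasma morphism maps lines into lines.  In a projective
  geometry lines determine all closures: the join of a closed set with a point is a union of lines,
  so by induction closures of finite sets are respected, and closure is finitary
  (\<open>matroid_morphism_of_plasma_morphism\<close>).
\<close>

section \<open>Categories and functors\<close>

lemma in_hom_iff: "f \<in> hom C a b \<longleftrightarrow> f \<in> arr C \<and> src C f = a \<and> tgt C f = b"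
  by (simp add: hom_def)

lemma concrete_category_simps [simp]:
  "obj (concrete_category Ob U Mor) = Ob"
  "src (concrete_category Ob U Mor) = source"
  "tgt (concrete_category Ob U Mor) = target"
  "ident (concrete_category Ob U Mor) X = Arrow X X (\<lambda>x \<in> U X. x)"
  "cmp (concrete_category Ob U Mor) g f =
     Arrow (source f) (target g) (compose (U (source f)) (mapping g) (mapping f))"
  by (simp_all add: concrete_category_def)

lemma arr_concrete_category_iff:
  "f \<in> arr (concrete_category Ob U Mor) \<longleftrightarrow>
     source f \<in> Ob \<and> target f \<in> Ob \<and> mapping f \<in> Mor (source f) (target f)"
  by (cases f) (auto simp: concrete_category_def)

lemma hom_concrete_category_iff:
  "f \<in> hom (concrete_category Ob U Mor) X Y \<longleftrightarrow>
     X \<in> Ob \<and> Y \<in> Ob \<and> source f = X \<and> target f = Y \<and> mapping f \<in> Mor X Y"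
  by (auto simp: in_hom_iff arr_concrete_category_iff)

lemma arrow_eqI:
  "source f = source g \<Longrightarrow> target f = target g \<Longrightarrow> mapping f = mapping g \<Longrightarrow> f = g"
  by (rule arrow.expand) simp

lemma is_category_concrete_category:
  assumes maps: "\<And>X Y f. X \<in> Ob \<Longrightarrow> Y \<in> Ob \<Longrightarrow> f \<in> Mor X Y \<Longrightarrow> f \<in> U X \<rightarrow>\<^sub>E U Y"
    and ident: "\<And>X. X \<in> Ob \<Longrightarrow> (\<lambda>x \<in> U X. x) \<in> Mor X X"
    and comp: "\<And>X Y Z f g. X \<in> Ob \<Longrightarrow> Y \<in> Ob \<Longrightarrow> Z \<in> Ob \<Longrightarrow> f \<in> Mor X Y \<Longrightarrow> g \<in> Mor Y Z
      \<Longrightarrow> compose (U X) g f \<in> Mor X Z"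
  shows "is_category (concrete_category Ob U Mor)"
  unfolding is_category_def
proof (intro conjI allI ballI)
  fix f X Y assume "f \<in> hom (concrete_category Ob U Mor) X Y"
  then have f: "source f = X" "target f = Y" "mapping f \<in> U X \<rightarrow>\<^sub>E U Y"
    using maps by (auto simp: hom_concrete_category_iff)
  show "cmp (concrete_category Ob U Mor) f (ident (concrete_category Ob U Mor) X) = f"
    using f by (auto intro!: arrow_eqI simp: compose_def fun_eq_iff PiE_iff extensional_def)
  show "cmp (concrete_category Ob U Mor) (ident (concrete_category Ob U Mor) Y) f = f"
    using f by (auto intro!: arrow_eqI extensionalityI[of _ "U X"] simp: compose_def PiE_iff)
next
  fix f g h W X Y Z
  assume "f \<in> hom (concrete_category Ob U Mor) W X" "g \<in> hom (concrete_category Ob U Mor) X Y"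
    "h \<in> hom (concrete_category Ob U Mor) Y Z"
  then show "cmp (concrete_category Ob U Mor) h (cmp (concrete_category Ob U Mor) g f) =
      cmp (concrete_category Ob U Mor) (cmp (concrete_category Ob U Mor) h g) f"
    using maps[of W X "mapping f"]
    by (auto simp: hom_concrete_category_iff compose_def fun_eq_iff)
qed (auto simp: hom_concrete_category_iff arr_concrete_category_iff ident comp)

lemma full_subcategory_simps [simp]:
  "obj (full_subcategory C P) = {a \<in> obj C. P a}"
  "arr (full_subcategory C P) = {f \<in> arr C. P (src C f) \<and> P (tgt C f)}"
  "src (full_subcategory C P) = src C"
  "tgt (full_subcategory C P) = tgt C"
  "ident (full_subcategory C P) = ident C"
  "cmp (full_subcategory C P) = cmp C"
  by (simp_all add: full_subcategory_def)

lemma hom_full_subcategory_iff: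
  "f \<in> hom (full_subcategory C P) a b \<longleftrightarrow> f \<in> hom C a b \<and> P a \<and> P b"
  by (auto simp: in_hom_iff)

lemma category_homD:
  assumes "is_category C" and "f \<in> hom C a b"
  shows "a \<in> obj C" "b \<in> obj C" "cmp C f (ident C a) = f" "cmp C (ident C b) f = f"
  using assms unfolding is_category_def by (auto simp: in_hom_iff)

lemma category_identI: "is_category C \<Longrightarrow> a \<in> obj C \<Longrightarrow> ident C a \<in> hom C a a"
  unfolding is_category_def by blast

lemma category_cmpI:
  "is_category C \<Longrightarrow> f \<in> hom C a b \<Longrightarrow> g \<in> hom C b c \<Longrightarrow> cmp C g f \<in> hom C a c"
  unfolding is_category_def by blast

lemma category_assoc:
  "is_category C \<Longrightarrow> f \<in> hom C a b \<Longrightarrow> g \<in> hom C b c \<Longrightarrow> h \<in> hom C c d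
     \<Longrightarrow> cmp C h (cmp C g f) = cmp C (cmp C h g) f"
  unfolding is_category_def by blast

lemma is_category_full_subcategory:
  assumes C: "is_category C"
  shows "is_category (full_subcategory C P)"
proof -
  have "src C f \<in> obj C \<and> tgt C f \<in> obj C" if "f \<in> arr C" for f
    using C that by (simp add: is_category_def)
  then show ?thesis
    unfolding is_category_def full_subcategory_simps hom_full_subcategory_iff
    by (auto simp: hom_full_subcategory_iff intro: category_identI[OF C] category_cmpI[OF C]
        category_homD(3,4)[OF C] category_assoc[OF C])
qed

lemma functorD:
  assumes "is_functor C D F"
  shows "is_category C" "is_category D"
    and "a \<in> obj C \<Longrightarrow> omap F a \<in> obj D"
    and "a \<in> obj C \<Longrightarrow> amap F (ident C a) = ident D (omap F a)"
    and "f \<in> hom C a b \<Longrightarrow> amap F f \<in> hom D (omap F a) (omap F b)"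
    and "f \<in> hom C a b \<Longrightarrow> g \<in> hom C b c \<Longrightarrow> amap F (cmp C g f) = cmp D (amap F g) (amap F f)"
    and "omap F \<in> extensional (obj C)" "amap F \<in> extensional (arr C)"
  using assms unfolding is_functor_def by (auto simp: in_hom_iff PiE_iff)

lemma functorI:
  assumes "is_category C" "is_category D"
    and "\<And>a. a \<in> obj C \<Longrightarrow> omap F a \<in> obj D"
    and "\<And>f a b. f \<in> hom C a b \<Longrightarrow> amap F f \<in> hom D (omap F a) (omap F b)"
    and "omap F \<in> extensional (obj C)" "amap F \<in> extensional (arr C)"
    and "\<And>a. a \<in> obj C \<Longrightarrow> amap F (ident C a) = ident D (omap F a)"
    and "\<And>f g a b c. f \<in> hom C a b \<Longrightarrow> g \<in> hom C b c
      \<Longrightarrow> amap F (cmp C g f) = cmp D (amap F g) (amap F f)"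
  shows "is_functor C D F"
  using assms unfolding is_functor_def by (simp add: in_hom_iff PiE_iff)

lemma comp_functor_simps [simp]:
  "a \<in> obj C \<Longrightarrow> omap (comp_functor C G F) a = omap G (omap F a)"
  "f \<in> arr C \<Longrightarrow> amap (comp_functor C G F) f = amap G (amap F f)"
  by (simp_all add: comp_functor_def compose_def)

lemma restrict_functor_simps [simp]:
  "a \<in> obj C \<Longrightarrow> omap (restrict_functor F C) a = omap F a"
  "f \<in> arr C \<Longrightarrow> amap (restrict_functor F C) f = amap F f"
  by (simp_all add: restrict_functor_def)

lemma is_functor_comp_functor:
  assumes F: "is_functor C D F" and G: "is_functor D E G"
  shows "is_functor C E (comp_functor C G F)"
proof (rule functorI)
  note C = functorD(1)[OF F]
  show "is_category C" "is_category E" by (rule functorD[OF F] functorD[OF G])+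
  show "omap (comp_functor C G F) \<in> extensional (obj C)"
    "amap (comp_functor C G F) \<in> extensional (arr C)"
    by (simp_all add: comp_functor_def)
  fix a assume a: "a \<in> obj C"
  then show "omap (comp_functor C G F) a \<in> obj E"
    using functorD[OF F] functorD[OF G] by simp
  show "amap (comp_functor C G F) (ident C a) = ident E (omap (comp_functor C G F) a)"
    using a category_identI[OF C a] functorD(3,4)[OF F a] functorD(4)[OF G]
    by (simp add: in_hom_iff)
next
  note C = functorD(1)[OF F]
  fix f a b assume f: "f \<in> hom C a b"
  show "amap (comp_functor C G F) f \<in>
      hom E (omap (comp_functor C G F) a) (omap (comp_functor C G F) b)"
    using f category_homD(1,2)[OF C f] functorD(5)[OF G functorD(5)[OF F f]]
    by (simp add: in_hom_iff)
  fix g c assume g: "g \<in> hom C b c"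
  show "amap (comp_functor C G F) (cmp C g f) =
      cmp E (amap (comp_functor C G F) g) (amap (comp_functor C G F) f)"
    using category_cmpI[OF C f g] f g functorD(6)[OF F f g]
      functorD(6)[OF G functorD(5)[OF F f] functorD(5)[OF F g]]
    by (simp add: in_hom_iff)
qed

lemma is_functor_restrict_functor:
  assumes F: "is_functor C D F"
  shows "is_functor (full_subcategory C P) D (restrict_functor F (full_subcategory C P))"
proof (rule functorI)
  note C = functorD(1)[OF F]
  show "is_category (full_subcategory C P)" "is_category D"
    using functorD(1,2)[OF F] is_category_full_subcategory by auto
  show "omap (restrict_functor F (full_subcategory C P)) \<in> extensional (obj (full_subcategory C P))"
    "amap (restrict_functor F (full_subcategory C P)) \<in> extensional (arr (full_subcategory C P))"
    by (simp_all add: restrict_functor_def)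
  fix a assume a: "a \<in> obj (full_subcategory C P)"
  then show "omap (restrict_functor F (full_subcategory C P)) a \<in> obj D"
    using functorD(3)[OF F] by simp
  show "amap (restrict_functor F (full_subcategory C P)) (ident (full_subcategory C P) a) =
      ident D (omap (restrict_functor F (full_subcategory C P)) a)"
    using a category_identI[OF C, of a] functorD(4)[OF F, of a] by (simp add: in_hom_iff)
next
  note C = functorD(1)[OF F]
  fix f a b assume f: "f \<in> hom (full_subcategory C P) a b"
  then have f': "f \<in> hom C a b" "P a" "P b" by (simp_all add: hom_full_subcategory_iff)
  show "amap (restrict_functor F (full_subcategory C P)) f \<in>
      hom D (omap (restrict_functor F (full_subcategory C P)) a)
        (omap (restrict_functor F (full_subcategory C P)) b)"
    using f f' category_homD(1,2)[OF C f'(1)] functorD(5)[OF F f'(1)] by (simp add: in_hom_iff)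
  fix g c assume g: "g \<in> hom (full_subcategory C P) b c"
  then have g': "g \<in> hom C b c" "P c" by (simp_all add: hom_full_subcategory_iff)
  show "amap (restrict_functor F (full_subcategory C P)) (cmp (full_subcategory C P) g f) =
      cmp D (amap (restrict_functor F (full_subcategory C P)) g)
        (amap (restrict_functor F (full_subcategory C P)) f)"
    using f' g' category_cmpI[OF C f'(1) g'(1)] functorD(6)[OF F f'(1) g'(1)]
    by (simp add: in_hom_iff)
qed

lemma faithful_comp_functor:
  assumes F: "faithful_functor C D F" and G: "faithful_functor D E G"
  shows "faithful_functor C E (comp_functor C G F)"
proof -
  have F': "is_functor C D F" and G': "is_functor D E G"
    using F G by (auto simp: faithful_functor_def)
  have "inj_on (amap (comp_functor C G F)) (hom C a b)" if "a \<in> obj C" "b \<in> obj C" for a b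
  proof (rule inj_onI)
    fix f g assume f: "f \<in> hom C a b" and g: "g \<in> hom C a b"
      and eq: "amap (comp_functor C G F) f = amap (comp_functor C G F) g"
    have "inj_on (amap G) (hom D (omap F a) (omap F b))"
      using G functorD(3)[OF F'] that by (auto simp: faithful_functor_def)
    then have "amap F f = amap F g"
      using functorD(5)[OF F' f] functorD(5)[OF F' g] eq f g
      by (auto dest: inj_onD simp: in_hom_iff)
    then show "f = g" using F that f g by (auto simp: faithful_functor_def dest: inj_onD)
  qed
  then show ?thesis using is_functor_comp_functor[OF F' G'] by (simp add: faithful_functor_def)
qed

lemma full_comp_functor:
  assumes F: "full_functor C D F" and G: "full_functor D E G"
  shows "full_functor C E (comp_functor C G F)"
proof -
  have F': "is_functor C D F" and G': "is_functor D E G"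
    using F G by (auto simp: full_functor_def)
  have "amap (comp_functor C G F) ` hom C a b =
      hom E (omap (comp_functor C G F) a) (omap (comp_functor C G F) b)"
    if "a \<in> obj C" "b \<in> obj C" for a b
  proof -
    have "amap (comp_functor C G F) ` hom C a b = amap G ` amap F ` hom C a b"
      by (auto simp: image_image in_hom_iff intro!: image_cong)
    then show ?thesis using F G functorD(3)[OF F'] that by (simp add: full_functor_def)
  qed
  then show ?thesis using is_functor_comp_functor[OF F' G'] by (simp add: full_functor_def)
qed

lemma faithful_restrict_functor:
  assumes "faithful_functor C D F"
  shows "faithful_functor (full_subcategory C P) D (restrict_functor F (full_subcategory C P))"
  using assms is_functor_restrict_functor[of C D F P]
  by (auto simp: faithful_functor_def inj_on_def hom_full_subcategory_iff in_hom_iff)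

text \<open>Restricting the composite amounts to restricting its first factor.  The second factor therefore
  keeps its whole domain, on which it is full.\<close>

lemma restrict_comp_functor:
  "restrict_functor (comp_functor C G F) (full_subcategory C P) =
    comp_functor (full_subcategory C P) G (restrict_functor F (full_subcategory C P))"
  by (auto simp: restrict_functor_def comp_functor_def compose_def fun_eq_iff)

lemma natural_transformationD:
  assumes "natural_transformation C D F G \<eta>"
  shows "is_functor C D F" "is_functor C D G" "\<eta> \<in> extensional (obj C)"
    and "a \<in> obj C \<Longrightarrow> \<eta> a \<in> hom D (omap F a) (omap G a)"
    and "f \<in> hom C a b \<Longrightarrow> cmp D (\<eta> b) (amap F f) = cmp D (amap G f) (\<eta> a)"
  using assms by (auto simp: natural_transformation_def in_hom_iff)

lemma natural_transformation_ident:
  assumes F: "is_functor C D F"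
  shows "natural_transformation C D F F (\<lambda>a \<in> obj C. ident D (omap F a))"
proof -
  have "cmp D (ident D (omap F (tgt C f))) (amap F f) = cmp D (amap F f) (ident D (omap F (src C f)))"
    if "f \<in> arr C" for f
    using category_homD(3,4)[OF functorD(2)[OF F] functorD(5)[OF F, of f "src C f" "tgt C f"]] that
    by (simp add: in_hom_iff)
  moreover have "src C f \<in> obj C \<and> tgt C f \<in> obj C" if "f \<in> arr C" for f
    using that functorD(1)[OF F] by (simp add: is_category_def)
  ultimately show ?thesis
    using F category_identI[OF functorD(2)[OF F]] functorD(3)[OF F]
    by (simp add: natural_transformation_def)
qed

lemma natural_transformation_cmp:
  assumes \<alpha>: "natural_transformation C D F G \<alpha>" and \<beta>: "natural_transformation C D G H \<beta>"
  shows "natural_transformation C D F H (\<lambda>a \<in> obj C. cmp D (\<beta> a) (\<alpha> a))"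
proof -
  note F = natural_transformationD(1)[OF \<alpha>] and G = natural_transformationD(2)[OF \<alpha>]
    and H = natural_transformationD(2)[OF \<beta>]
  note D = functorD(2)[OF F]
  have "cmp D (cmp D (\<beta> (tgt C f)) (\<alpha> (tgt C f))) (amap F f) =
      cmp D (amap H f) (cmp D (\<beta> (src C f)) (\<alpha> (src C f)))" if "f \<in> arr C" for f
  proof -
    have f: "f \<in> hom C (src C f) (tgt C f)" using that by (simp add: in_hom_iff)
    note ab = category_homD(1,2)[OF functorD(1)[OF F] f]
    note \<alpha>f = natural_transformationD(4)[OF \<alpha>] and \<beta>f = natural_transformationD(4)[OF \<beta>]
    have "cmp D (cmp D (\<beta> (tgt C f)) (\<alpha> (tgt C f))) (amap F f) =
        cmp D (\<beta> (tgt C f)) (cmp D (\<alpha> (tgt C f)) (amap F f))"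
      using category_assoc[OF D functorD(5)[OF F f] \<alpha>f \<beta>f] ab by simp
    also have "\<dots> = cmp D (\<beta> (tgt C f)) (cmp D (amap G f) (\<alpha> (src C f)))"
      using natural_transformationD(5)[OF \<alpha> f] by simp
    also have "\<dots> = cmp D (cmp D (\<beta> (tgt C f)) (amap G f)) (\<alpha> (src C f))"
      using category_assoc[OF D \<alpha>f functorD(5)[OF G f] \<beta>f] ab by simp
    also have "\<dots> = cmp D (cmp D (amap H f) (\<beta> (src C f))) (\<alpha> (src C f))"
      using natural_transformationD(5)[OF \<beta> f] by simp
    also have "\<dots> = cmp D (amap H f) (cmp D (\<beta> (src C f)) (\<alpha> (src C f)))"
      using category_assoc[OF D \<alpha>f \<beta>f functorD(5)[OF H f]] ab by simp
    finally show ?thesis .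
  qed
  moreover have "src C f \<in> obj C \<and> tgt C f \<in> obj C" if "f \<in> arr C" for f
    using that functorD(1)[OF F] by (simp add: is_category_def)
  moreover have "cmp D (\<beta> a) (\<alpha> a) \<in> hom D (omap F a) (omap H a)" if "a \<in> obj C" for a
    using category_cmpI[OF D natural_transformationD(4)[OF \<alpha> that]
        natural_transformationD(4)[OF \<beta> that]] .
  ultimately show ?thesis
    using F H by (simp add: natural_transformation_def)
qed

lemma functor_category_simps [simp]:
  "obj (functor_category C D) = {F. is_functor C D F}"
  "src (functor_category C D) = source"
  "tgt (functor_category C D) = target"
  "ident (functor_category C D) F = Arrow F F (\<lambda>a \<in> obj C. ident D (omap F a))"
  "cmp (functor_category C D) \<beta> \<alpha> = Arrow (source \<alpha>) (target \<beta>)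
     (\<lambda>a \<in> obj C. cmp D (mapping \<beta> a) (mapping \<alpha> a))"
  by (simp_all add: functor_category_def)

lemma hom_functor_category_iff:
  "\<alpha> \<in> hom (functor_category C D) F G \<longleftrightarrow>
     source \<alpha> = F \<and> target \<alpha> = G \<and> natural_transformation C D F G (mapping \<alpha>)"
  by (cases \<alpha>) (auto simp: in_hom_iff functor_category_def)

lemma arr_functor_category_iff:
  "\<alpha> \<in> arr (functor_category C D) \<longleftrightarrow>
     natural_transformation C D (source \<alpha>) (target \<alpha>) (mapping \<alpha>)"
  by (cases \<alpha>) (auto simp: functor_category_def)

lemma is_category_functor_category: "is_category (functor_category C D)"
  unfolding is_category_def
proof (intro conjI allI ballI)
  fix \<alpha> F G assume "\<alpha> \<in> hom (functor_category C D) F G"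
  then have \<alpha>: "source \<alpha> = F" "target \<alpha> = G" "natural_transformation C D F G (mapping \<alpha>)"
    by (auto simp: hom_functor_category_iff)
  note component = natural_transformationD(4)[OF \<alpha>(3)]
    and D = functorD(2)[OF natural_transformationD(1)[OF \<alpha>(3)]]
    and ext = natural_transformationD(3)[OF \<alpha>(3)]
  show "cmp (functor_category C D) \<alpha> (ident (functor_category C D) F) = \<alpha>"
    using \<alpha> category_homD(3)[OF D component] ext
    by (auto intro!: arrow_eqI extensionalityI[of _ "obj C"])
  show "cmp (functor_category C D) (ident (functor_category C D) G) \<alpha> = \<alpha>"
    using \<alpha> category_homD(4)[OF D component] ext
    by (auto intro!: arrow_eqI extensionalityI[of _ "obj C"])
next
  fix \<alpha> \<beta> \<gamma> F G H K
  assume hyps: "\<alpha> \<in> hom (functor_category C D) F G" "\<beta> \<in> hom (functor_category C D) G H"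
    "\<gamma> \<in> hom (functor_category C D) H K"
  then have nt: "natural_transformation C D F G (mapping \<alpha>)"
    "natural_transformation C D G H (mapping \<beta>)" "natural_transformation C D H K (mapping \<gamma>)"
    by (auto simp: hom_functor_category_iff)
  have "cmp D (mapping \<gamma> a) (cmp D (mapping \<beta> a) (mapping \<alpha> a)) =
      cmp D (cmp D (mapping \<gamma> a) (mapping \<beta> a)) (mapping \<alpha> a)" if "a \<in> obj C" for a
    using nt[THEN natural_transformationD(4), OF that] functorD(2)[OF natural_transformationD(1)[OF nt(1)]]
    by (intro category_assoc)
  then show "cmp (functor_category C D) \<gamma> (cmp (functor_category C D) \<beta> \<alpha>) =
      cmp (functor_category C D) (cmp (functor_category C D) \<gamma> \<beta>) \<alpha>"
    using hyps by (simp add: hom_functor_category_iff cong: restrict_cong)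
qed (auto simp: hom_functor_category_iff arr_functor_category_iff
    intro: natural_transformation_cmp natural_transformation_ident natural_transformationD(1,2))


section \<open>The categories involved\<close>

lemma pointed_matroid_morphismsD:
  assumes "f \<in> pointed_matroid_morphisms M N"
  shows "f \<in> ground M \<rightarrow>\<^sub>E ground N" "f (mpt M) = mpt N"
    and "A \<subseteq> ground M \<Longrightarrow> x \<in> cl M A \<Longrightarrow> f x \<in> cl N (f ` A)"
  using assms unfolding pointed_matroid_morphisms_def matroid_morphisms_def by blast+

lemma pointed_matroid_morphismsI:
  assumes "f \<in> ground M \<rightarrow>\<^sub>E ground N" "f (mpt M) = mpt N"
    and "\<And>A x. A \<subseteq> ground M \<Longrightarrow> x \<in> cl M A \<Longrightarrow> f x \<in> cl N (f ` A)"
  shows "f \<in> pointed_matroid_morphisms M N"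
  using assms by (simp add: pointed_matroid_morphisms_def matroid_morphisms_def image_subset_iff)

lemma is_matroidD:
  assumes "is_matroid M"
  shows "A \<subseteq> ground M \<Longrightarrow> cl M A \<subseteq> ground M"
    and "A \<subseteq> ground M \<Longrightarrow> A \<subseteq> cl M A"
    and "A \<subseteq> B \<Longrightarrow> B \<subseteq> ground M \<Longrightarrow> cl M A \<subseteq> cl M B"
    and "A \<subseteq> ground M \<Longrightarrow> cl M (cl M A) = cl M A"
    and "A \<subseteq> ground M \<Longrightarrow> x \<in> ground M \<Longrightarrow> y \<in> ground M \<Longrightarrow> x \<in> cl M (insert y A)
      \<Longrightarrow> x \<notin> cl M A \<Longrightarrow> y \<in> cl M (insert x A)"
  using assms by (auto simp: is_matroid_def PiE_iff)

lemma simple_pointed_matroidD: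
  assumes "is_pointed_matroid M" "is_simple M"
  shows "is_matroid M" "mpt M \<in> ground M" "cl M {} = {mpt M}"
    and "x \<in> ground M \<Longrightarrow> cl M {x} = {mpt M, x}"
  using assms is_matroidD(1)[of M "{}"] by (auto simp: is_pointed_matroid_def is_simple_def)

lemma is_category_sMat: "is_category sMat"
  unfolding sMat_def
proof (rule is_category_concrete_category)
  fix X Y Z :: "'a pointed_matroid" and f g
  assume X: "X \<in> {M. is_pointed_matroid M \<and> is_simple M}"
    and f: "f \<in> pointed_matroid_morphisms X Y" and g: "g \<in> pointed_matroid_morphisms Y Z"
  note X' = simple_pointed_matroidD[of X] and f' = pointed_matroid_morphismsD[OF f]
    and g' = pointed_matroid_morphismsD[OF g]
  have cl: "compose (ground X) g f x \<in> cl Z (compose (ground X) g f ` A)"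
    if A: "A \<subseteq> ground X" and x: "x \<in> cl X A" for A x
  proof -
    have "x \<in> ground X" using is_matroidD(1)[of X A] X X' A x by auto
    moreover have "compose (ground X) g f ` A = g ` f ` A"
      using A by (auto simp: compose_def image_iff)
    moreover have "f ` A \<subseteq> ground Y" using f'(1) A by blast
    ultimately show ?thesis using f'(3)[OF A x] g'(3) by (simp add: compose_def)
  qed
  have maps: "compose (ground X) g f \<in> ground X \<rightarrow>\<^sub>E ground Z"
    using f'(1) g'(1) by (auto simp: compose_def)
  have base: "compose (ground X) g f (mpt X) = mpt Z"
    using X X'(2) f'(2) g'(2) by (simp add: compose_def)
  show "compose (ground X) g f \<in> pointed_matroid_morphisms X Z"
    by (rule pointed_matroid_morphismsI) (fact maps base | erule (1) cl)+
next
  fix X :: "'a pointed_matroid"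
  assume "X \<in> {M. is_pointed_matroid M \<and> is_simple M}"
  note X' = simple_pointed_matroidD[of X] this
  have "(\<lambda>x \<in> ground X. x) ` cl X A \<subseteq> cl X ((\<lambda>x \<in> ground X. x) ` A)" if "A \<subseteq> ground X" for A
  proof -
    have "(\<lambda>x \<in> ground X. x) ` B = B" if "B \<subseteq> ground X" for B
      using that by (force simp: image_iff)
    then show ?thesis using that is_matroidD(1)[of X A] X' by simp
  qed
  then show "(\<lambda>x \<in> ground X. x) \<in> pointed_matroid_morphisms X X"
    using X' by (auto simp: pointed_matroid_morphisms_def matroid_morphisms_def)
qed (rule pointed_matroid_morphismsD)

lemma is_plasmaD:
  assumes "is_plasma M"
  shows "a \<in> elts M \<Longrightarrow> b \<in> elts M \<Longrightarrow> padd M a b \<subseteq> elts M" "pzero M \<in> elts M"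
    and "a \<in> elts M \<Longrightarrow> a \<in> padd M (pzero M) a"
    and "a \<in> elts M \<Longrightarrow> a \<in> padd M a (pzero M)"
    and "a \<in> elts M \<Longrightarrow> b \<in> elts M \<Longrightarrow> padd M a b = padd M b a"
  using assms by (auto simp: is_plasma_def PiE_iff Pow_def Pi_iff)

lemma plasma_morphismsD:
  assumes "f \<in> plasma_morphisms M N"
  shows "f \<in> elts M \<rightarrow>\<^sub>E elts N" "f (pzero M) = pzero N"
    and "a \<in> elts M \<Longrightarrow> b \<in> elts M \<Longrightarrow> c \<in> padd M a b \<Longrightarrow> f c \<in> padd N (f a) (f b)"
  using assms unfolding plasma_morphisms_def by blast+

lemma plasma_morphismsI:
  assumes "f \<in> elts M \<rightarrow>\<^sub>E elts N" "f (pzero M) = pzero N"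
    and "\<And>a b c. a \<in> elts M \<Longrightarrow> b \<in> elts M \<Longrightarrow> c \<in> padd M a b \<Longrightarrow> f c \<in> padd N (f a) (f b)"
  shows "f \<in> plasma_morphisms M N"
  using assms by (simp add: plasma_morphisms_def image_subset_iff)

lemma is_category_Plas: "is_category Plas"
  unfolding Plas_def
proof (rule is_category_concrete_category)
  fix X Y Z :: "'a plasma" and f g
  assume "X \<in> {M. is_plasma M}" and f: "f \<in> plasma_morphisms X Y" and g: "g \<in> plasma_morphisms Y Z"
  then have X: "is_plasma X" by simp
  note f' = plasma_morphismsD[OF f] and g' = plasma_morphismsD[OF g]
  have add: "compose (elts X) g f c \<in> padd Z (compose (elts X) g f a) (compose (elts X) g f b)"
    if abc: "a \<in> elts X" "b \<in> elts X" "c \<in> padd X a b" for a b c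
  proof -
    have "c \<in> elts X" using is_plasmaD(1)[OF X abc(1,2)] abc(3) by blast
    moreover have "f a \<in> elts Y" "f b \<in> elts Y" using f'(1) abc by auto
    ultimately show ?thesis using g'(3)[OF _ _ f'(3)[OF abc]] abc by (simp add: compose_def)
  qed
  have maps: "compose (elts X) g f \<in> elts X \<rightarrow>\<^sub>E elts Z"
    using f'(1) g'(1) by (auto simp: compose_def)
  have base: "compose (elts X) g f (pzero X) = pzero Z"
    using is_plasmaD(2)[OF X] f'(2) g'(2) by (simp add: compose_def)
  show "compose (elts X) g f \<in> plasma_morphisms X Z"
    by (rule plasma_morphismsI) (fact maps base | erule (2) add)+
next
  fix X :: "'a plasma"
  assume "X \<in> {M. is_plasma M}"
  then have "is_plasma X" by simp
  note X = is_plasmaD[OF this]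
  show "(\<lambda>x \<in> elts X. x) \<in> plasma_morphisms X X"
  proof (rule plasma_morphismsI)
    fix a b c assume abc: "a \<in> elts X" "b \<in> elts X" "c \<in> padd X a b"
    then have "c \<in> elts X" using X(1)[OF abc(1,2)] by blast
    then show "(\<lambda>x \<in> elts X. x) c \<in>
        padd X ((\<lambda>x \<in> elts X. x) a) ((\<lambda>x \<in> elts X. x) b)"
      using abc by simp
  qed (simp_all add: X(2))
qed (rule plasma_morphismsD)

lemma is_category_Set_pt: "is_category Set_pt"
  unfolding Set_pt_def by (rule is_category_concrete_category) (auto simp: compose_def)

lemma is_category_Fin_pt: "is_category Fin_pt"
  unfolding Fin_pt_def by (rule is_category_concrete_category) (auto simp: compose_def PiE_iff)

lemma hom_Set_pt_iff:
  "h \<in> hom Set_pt X Y \<longleftrightarrow> base X \<in> pcarrier X \<and> base Y \<in> pcarrier Y \<and> source h = X \<and>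
     target h = Y \<and> mapping h \<in> pcarrier X \<rightarrow>\<^sub>E pcarrier Y \<and> mapping h (base X) = base Y"
  by (simp add: Set_pt_def hom_concrete_category_iff)

lemma hom_Fin_pt_iff:
  "\<phi> \<in> hom Fin_pt n m \<longleftrightarrow> source \<phi> = n \<and> target \<phi> = m \<and>
     mapping \<phi> \<in> {0..n} \<rightarrow>\<^sub>E {0..m} \<and> mapping \<phi> 0 = 0"
  by (simp add: Fin_pt_def hom_concrete_category_iff)

lemma hom_Plas_iff:
  "f \<in> hom Plas M N \<longleftrightarrow> is_plasma M \<and> is_plasma N \<and> source f = M \<and> target f = N \<and>
     mapping f \<in> plasma_morphisms M N"
  by (simp add: Plas_def hom_concrete_category_iff)

lemma hom_sMat_iff:
  "f \<in> hom sMat M N \<longleftrightarrow> is_pointed_matroid M \<and> is_simple M \<and> is_pointed_matroid N \<and> is_simple N \<and>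
     source f = M \<and> target f = N \<and> mapping f \<in> pointed_matroid_morphisms M N"
  by (auto simp: sMat_def hom_concrete_category_iff)


section \<open>The plasma of a simple matroid\<close>

lemma matroid_plasma_simps [simp]:
  "elts (matroid_plasma M) = ground M"
  "pzero (matroid_plasma M) = mpt M"
  by (simp_all add: matroid_plasma_def)

lemma padd_matroid_plasma:
  "x \<in> ground M \<Longrightarrow> y \<in> ground M \<Longrightarrow> padd (matroid_plasma M) x y =
     (if x = mpt M then {y} else if y = mpt M then {x} else if x = y then {x, mpt M}
      else cl M {x, y} - {x, y, mpt M})"
  by (simp add: matroid_plasma_def)

lemma is_plasma_matroid_plasma:
  assumes M: "is_pointed_matroid M" "is_simple M"
  shows "is_plasma (matroid_plasma M)"
proof -
  note M' = simple_pointed_matroidD[OF M]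
  have "padd (matroid_plasma M) x y \<subseteq> ground M" if "x \<in> ground M" "y \<in> ground M" for x y
    using that M'(2) is_matroidD(1)[OF M'(1), of "{x, y}"] by (auto simp: padd_matroid_plasma)
  moreover have "padd (matroid_plasma M) \<in> extensional (ground M)"
    "\<And>x. x \<in> ground M \<Longrightarrow> padd (matroid_plasma M) x \<in> extensional (ground M)"
    by (simp_all add: matroid_plasma_def)
  ultimately show ?thesis
    using M'(2) by (auto simp: is_plasma_def PiE_iff padd_matroid_plasma insert_commute)
qed

text \<open>The exchange axiom over the flat \<open>{x, 0}\<close>: the line through \<open>x\<close> and \<open>y\<close> is spanned by \<open>x\<close> and
  any of its other nonzero points.\<close>

lemma cl_pair_rotate:
  assumes M: "is_pointed_matroid M" "is_simple M"
    and "x \<in> ground M" "y \<in> ground M" "z \<in> cl M {x, y}" "z \<noteq> x" "z \<noteq> mpt M"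
  shows "y \<in> cl M {x, z}"
proof -
  note M' = simple_pointed_matroidD[OF M]
  have "z \<in> ground M" using is_matroidD(1)[OF M'(1), of "{x, y}"] assms by auto
  then show ?thesis
    using is_matroidD(5)[OF M'(1), of "{x}" z y] M'(4)[of x] assms by (auto simp: insert_commute)
qed

text \<open>What has to be excluded is that \<open>f\<close> sends a third point \<open>z\<close> of the line through \<open>x\<close> and \<open>y\<close> to one
  of the removed points \<open>f x\<close>, \<open>f y\<close>, \<open>0\<close>, or to \<open>0\<close> when exactly one of \<open>f x\<close>, \<open>f y\<close> is \<open>0\<close>.  By exchange, each of \<open>f x\<close>, \<open>f y\<close>, \<open>f z\<close> lies in the closure of the other two.
  If two of the three coincide, or one of them is \<open>0\<close>, the closure of these two, or of that one and
  any other, is \<open>{0, u}\<close> for a point \<open>u\<close>, and the memberships leave only the values that the definition of \<open>\<boxplus>\<close> allows.\<close>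

lemma plasma_morphism_of_matroid_morphism:
  assumes M: "is_pointed_matroid M" "is_simple M" and N: "is_pointed_matroid N" "is_simple N"
    and f: "f \<in> pointed_matroid_morphisms M N"
  shows "f \<in> plasma_morphisms (matroid_plasma M) (matroid_plasma N)"
proof -
  note M' = simple_pointed_matroidD[OF M] and N' = simple_pointed_matroidD[OF N]
    and f' = pointed_matroid_morphismsD[OF f]
  have fin: "f x \<in> ground N" if "x \<in> ground M" for x using f'(1) that by blast
  have pair: "f z \<in> cl N {f x, f y}" if "x \<in> ground M" "y \<in> ground M" "z \<in> cl M {x, y}" for x y z
    using f'(3)[of "{x, y}" z] that by simp
  have base: "cl N {mpt N, u} = {mpt N, u}" "cl N {u, mpt N} = {mpt N, u}" if "u \<in> ground N" for u
    using is_matroidD(4)[OF N'(1), of "{u}"] N'(4)[OF that] that by (simp_all add: insert_commute)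
  have add: "f z \<in> padd (matroid_plasma N) (f x) (f y)"
    if x: "x \<in> ground M" and y: "y \<in> ground M" and z: "z \<in> padd (matroid_plasma M) x y" for x y z
  proof (cases "x = mpt M \<or> y = mpt M \<or> x = y")
    case True
    then show ?thesis
      using x y z fin f'(2) by (auto simp: padd_matroid_plasma split: if_splits)
  next
    case False
    then have zc: "z \<in> cl M {x, y}" "z \<noteq> x" "z \<noteq> y" "z \<noteq> mpt M"
      using x y z by (auto simp: padd_matroid_plasma)
    have zM: "z \<in> ground M" using is_matroidD(1)[OF M'(1), of "{x, y}"] x y zc by auto
    \<comment> \<open>The three memberships between which the exchange axiom rotates.\<close>
    have fz: "f z \<in> cl N {f x, f y}" using pair[OF x y zc(1)] .
    have fy: "f y \<in> cl N {f x, f z}"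
      using pair[OF x zM] cl_pair_rotate[OF M x y zc(1,2,4)] by simp
    have fx: "f x \<in> cl N {f y, f z}"
      using pair[OF y zM] cl_pair_rotate[OF M y x, of z] zc by (simp add: insert_commute)
    show ?thesis
      using fx fy fz base fin[OF x] fin[OF y] fin[OF zM] N'(4)
      by (auto simp: padd_matroid_plasma)
  qed
  show ?thesis by (rule plasma_morphismsI) (simp_all add: f'(1,2) add)
qed

lemma is_functor_Pi: "is_functor sMat Plas Pi_functor"
proof (rule functorI)
  show "is_category sMat" "is_category Plas" by (rule is_category_sMat is_category_Plas)+
  show "omap Pi_functor \<in> extensional (obj sMat)" "amap Pi_functor \<in> extensional (arr sMat)"
    by (simp_all add: Pi_functor_def)
  fix M :: "'a pointed_matroid" assume M: "M \<in> obj sMat"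
  then show "omap Pi_functor M \<in> obj Plas"
    by (simp add: Pi_functor_def sMat_def Plas_def is_plasma_matroid_plasma)
  show "amap Pi_functor (ident sMat M) = ident Plas (omap Pi_functor M)"
    using M category_identI[OF is_category_sMat M]
    by (simp add: Pi_functor_def in_hom_iff) (simp add: sMat_def Plas_def)
next
  fix f :: "('a pointed_matroid, 'a \<Rightarrow> 'a) arrow" and M N assume f: "f \<in> hom sMat M N"
  note MN = category_homD(1,2)[OF is_category_sMat f]
  show "amap Pi_functor f \<in> hom Plas (omap Pi_functor M) (omap Pi_functor N)"
    using f MN plasma_morphism_of_matroid_morphism is_plasma_matroid_plasma
    by (auto simp: Pi_functor_def in_hom_iff hom_sMat_iff[unfolded in_hom_iff]
        hom_Plas_iff[unfolded in_hom_iff]) (auto simp: sMat_def Plas_def arr_concrete_category_iff)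
  fix g K assume g: "g \<in> hom sMat N K"
  show "amap Pi_functor (cmp sMat g f) = cmp Plas (amap Pi_functor g) (amap Pi_functor f)"
    using f g category_cmpI[OF is_category_sMat f g]
    by (simp add: Pi_functor_def in_hom_iff) (simp add: sMat_def Plas_def)
qed

lemma amap_Pi_functor:
  "f \<in> hom sMat M N \<Longrightarrow> amap Pi_functor f =
     Arrow (matroid_plasma M) (matroid_plasma N) (mapping f)"
  by (auto simp: Pi_functor_def in_hom_iff sMat_def)

lemma faithful_Pi: "faithful_functor sMat Plas Pi_functor"
  unfolding faithful_functor_def
proof (intro conjI ballI is_functor_Pi inj_onI)
  fix M N f g
  assume "f \<in> hom sMat M N" "g \<in> hom sMat M N" "amap Pi_functor f = amap Pi_functor g"
  then show "f = g" by (auto simp: amap_Pi_functor hom_sMat_iff intro: arrow_eqI)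
qed

text \<open>As rewrite rules the two axioms below loop, because closures occur on both sides; they are
  restated as existence of witnesses.\<close>

lemma projective_geometryD:
  assumes "is_projective_geometry M"
  shows "is_pointed_matroid M" "is_simple M"
    and "A \<subseteq> ground M \<Longrightarrow> x \<in> cl M A \<Longrightarrow> \<exists>B \<subseteq> A. finite B \<and> x \<in> cl M B"
    and "A \<subseteq> ground M \<Longrightarrow> B \<subseteq> ground M \<Longrightarrow> z \<in> cl M (A \<union> B)
      \<Longrightarrow> \<exists>x \<in> cl M A. \<exists>y \<in> cl M B. z \<in> cl M {x, y}"
proof -
  show "is_pointed_matroid M" "is_simple M" using assms by (simp_all add: is_projective_geometry_def)
  show "\<exists>B \<subseteq> A. finite B \<and> x \<in> cl M B" if "A \<subseteq> ground M" "x \<in> cl M A"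
  proof -
    have "cl M A = \<Union> {cl M B | B. B \<subseteq> A \<and> finite B}"
      using assms that(1) by (simp add: is_projective_geometry_def)
    then have "x \<in> \<Union> {cl M B | B. B \<subseteq> A \<and> finite B}"
      using that(2) by (rule equalityD1[THEN subsetD])
    then show ?thesis by blast
  qed
  show "\<exists>x \<in> cl M A. \<exists>y \<in> cl M B. z \<in> cl M {x, y}"
    if "A \<subseteq> ground M" "B \<subseteq> ground M" "z \<in> cl M (A \<union> B)"
  proof -
    have "\<forall>A B. A \<subseteq> ground M \<and> B \<subseteq> ground M \<longrightarrow>
        cl M (A \<union> B) = \<Union> {cl M {x, y} | x y. x \<in> cl M A \<and> y \<in> cl M B}"
      using assms unfolding is_projective_geometry_def by (elim conjE)
    then have "cl M (A \<union> B) = \<Union> {cl M {x, y} | x y. x \<in> cl M A \<and> y \<in> cl M B}"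
      using that(1,2) by (elim allE impE) (rule conjI)
    then have "z \<in> \<Union> {cl M {x, y} | x y. x \<in> cl M A \<and> y \<in> cl M B}"
      using that(3) by (rule equalityD1[THEN subsetD])
    then show ?thesis by blast
  qed
qed

text \<open>Closures of pairs are respected because \<open>x \<boxplus> y\<close> fills up the line apart from \<open>x\<close>, \<open>y\<close>, \<open>0\<close>.
  For a finite set, adding a point \<open>b\<close> to \<open>A\<close> adjoins the lines from points \<open>x\<close> of the closure of
  \<open>A\<close> to points \<open>y\<close> of the closure of \<open>b\<close>; the image of such a line lies on the line through \<open>f x\<close>
  and \<open>f y\<close>, hence in the closed set spanned by the image of \<open>A\<close> and \<open>b\<close>.\<close>

lemma matroid_morphism_of_plasma_morphism:
  assumes M: "is_projective_geometry M" and N: "is_pointed_matroid N" "is_simple N"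
    and f: "f \<in> plasma_morphisms (matroid_plasma M) (matroid_plasma N)"
  shows "f \<in> pointed_matroid_morphisms M N"
proof -
  note P = projective_geometryD[OF M]
  note M' = simple_pointed_matroidD[OF P(1,2)] and N' = simple_pointed_matroidD[OF N]
  note f' = plasma_morphismsD[OF f, simplified]
  have fin: "f x \<in> ground N" if "x \<in> ground M" for x using f'(1) that by blast
  have pair: "f z \<in> cl N {f x, f y}"
    if x: "x \<in> ground M" and y: "y \<in> ground M" and z: "z \<in> cl M {x, y}" for x y z
  proof -
    have sub: "{f x, f y} \<subseteq> ground N" using fin x y by simp
    have mem: "f x \<in> cl N {f x, f y}" "f y \<in> cl N {f x, f y}" "mpt N \<in> cl N {f x, f y}"
      using is_matroidD(2)[OF N'(1) sub] is_matroidD(3)[OF N'(1) _ sub, of "{}"] N'(3) by auto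
    \<comment> \<open>A degenerate pair spans nothing beyond itself and \<open>0\<close>.\<close>
    have z_cases: "z \<in> {x, y, mpt M}" if "x = mpt M \<or> y = mpt M \<or> x = y"
      using that z x y is_matroidD(4)[OF M'(1), of "{x}"] is_matroidD(4)[OF M'(1), of "{y}"] M'(4)
      by (auto simp: insert_commute)
    show ?thesis
    proof (cases "z \<in> {x, y, mpt M}")
      case True
      then show ?thesis using mem f'(2) by auto
    next
      case False
      then have "z \<in> padd (matroid_plasma M) x y"
        using z z_cases x y by (auto simp: padd_matroid_plasma)
      then have "f z \<in> padd (matroid_plasma N) (f x) (f y)" by (rule f'(3)[OF x y])
      moreover have "padd (matroid_plasma N) (f x) (f y) \<subseteq> cl N {f x, f y}"
        using fin[OF x] fin[OF y] mem by (simp only: padd_matroid_plasma split: if_split) blast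
      ultimately show ?thesis by blast
    qed
  qed
  have finite_case: "finite A \<Longrightarrow> A \<subseteq> ground M \<Longrightarrow> z \<in> cl M A \<Longrightarrow> f z \<in> cl N (f ` A)" for A z
  proof (induction A arbitrary: z rule: finite_induct)
    case empty
    then show ?case using M'(3) N'(3) f'(2) by simp
  next
    case (insert b A)
    then have A: "A \<subseteq> ground M" and b: "b \<in> ground M" by auto
    then obtain x y where x: "x \<in> cl M A" and y: "y \<in> cl M {b}" and z: "z \<in> cl M {x, y}"
      using P(4)[of A "{b}" z] insert.prems by auto
    have xM: "x \<in> ground M" and yM: "y \<in> ground M"
      using is_matroidD(1)[OF M'(1)] A b x y by blast+
    let ?K = "cl N (f ` insert b A)"
    have sub: "f ` insert b A \<subseteq> ground N" using fin A b by auto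
    have "f x \<in> ?K"
      using insert.IH[OF A x] is_matroidD(3)[OF N'(1) _ sub, of "f ` A"] by auto
    moreover have "f y \<in> cl N {f b}" using pair[OF b b] y by simp
    then have "f y \<in> ?K" using is_matroidD(3)[OF N'(1) _ sub, of "{f b}"] by auto
    \<comment> \<open>The closed set \<open>?K\<close> contains the line through any two of its points.\<close>
    ultimately have "cl N {f x, f y} \<subseteq> cl N ?K"
      using is_matroidD(3)[OF N'(1), of "{f x, f y}" ?K] is_matroidD(1)[OF N'(1) sub] by simp
    then show ?case using pair[OF xM yM z] is_matroidD(4)[OF N'(1) sub] by auto
  qed
  have cl: "f z \<in> cl N (f ` A)" if A: "A \<subseteq> ground M" and z: "z \<in> cl M A" for A z
  proof -
    obtain B where B: "B \<subseteq> A" "finite B" "z \<in> cl M B" using P(3)[OF A z] by blast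
    then have "f z \<in> cl N (f ` B)" using finite_case A by auto
    moreover have "f ` A \<subseteq> ground N" using fin A by auto
    ultimately show ?thesis
      using is_matroidD(3)[OF N'(1) image_mono[OF B(1), of f]] by blast
  qed
  show ?thesis by (rule pointed_matroid_morphismsI) (fact f'(1,2) | erule (1) cl)+
qed

lemma full_Pi_on_Proj: "full_functor Proj Plas (restrict_functor Pi_functor Proj)"
  unfolding full_functor_def
proof (intro conjI ballI)
  show R: "is_functor Proj Plas (restrict_functor Pi_functor Proj)"
    unfolding Proj_def by (rule is_functor_restrict_functor[OF is_functor_Pi])
  fix M N :: "'a pointed_matroid" assume MN: "M \<in> obj Proj" "N \<in> obj Proj"
  then have P: "is_projective_geometry M" "is_projective_geometry N"
    by (auto simp: Proj_def)
  note s = projective_geometryD(1,2)[OF P(1)] projective_geometryD(1,2)[OF P(2)]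
  have hom_iff: "f \<in> hom Proj M N \<longleftrightarrow> f \<in> hom sMat M N" for f
    using P by (simp add: Proj_def hom_full_subcategory_iff)
  have omap: "omap (restrict_functor Pi_functor Proj) K = matroid_plasma K" if "K \<in> obj Proj" for K
    using that by (simp add: Pi_functor_def) (simp add: Proj_def)
  have amap: "amap (restrict_functor Pi_functor Proj) f =
      Arrow (matroid_plasma M) (matroid_plasma N) (mapping f)" if "f \<in> hom Proj M N" for f
    using amap_Pi_functor[of f M N] hom_iff[of f] that by (simp add: in_hom_iff[of f Proj])
  show "amap (restrict_functor Pi_functor Proj) ` hom Proj M N =
      hom Plas (omap (restrict_functor Pi_functor Proj) M) (omap (restrict_functor Pi_functor Proj) N)"
  proof (intro equalityI subsetI)
    fix g assume "g \<in> amap (restrict_functor Pi_functor Proj) ` hom Proj M N"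
    then show "g \<in> hom Plas (omap (restrict_functor Pi_functor Proj) M)
        (omap (restrict_functor Pi_functor Proj) N)"
      using functorD(5)[OF R] by blast
  next
    fix g assume "g \<in> hom Plas (omap (restrict_functor Pi_functor Proj) M)
        (omap (restrict_functor Pi_functor Proj) N)"
    then have g: "source g = matroid_plasma M" "target g = matroid_plasma N"
      "mapping g \<in> plasma_morphisms (matroid_plasma M) (matroid_plasma N)"
      by (simp_all only: omap[OF MN(1)] omap[OF MN(2)] hom_Plas_iff)
    then have "Arrow M N (mapping g) \<in> hom Proj M N"
      using matroid_morphism_of_plasma_morphism[OF P(1) s(3,4)] s by (simp add: hom_iff hom_sMat_iff)
    moreover have "g = amap (restrict_functor Pi_functor Proj) (Arrow M N (mapping g))"
      unfolding amap[OF calculation] by (rule arrow_eqI) (simp_all add: g)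
    ultimately show "g \<in> amap (restrict_functor Pi_functor Proj) ` hom Proj M N" by blast
  qed
qed


section \<open>The module of a plasma\<close>

lemma Hhat_setD:
  assumes "x \<in> Hhat_set M n"
  shows "x \<in> Pow {1..n} \<rightarrow>\<^sub>E elts M" "x {} = pzero M"
    and "S \<subseteq> {1..n} \<Longrightarrow> T \<subseteq> {1..n} \<Longrightarrow> S \<inter> T = {} \<Longrightarrow> x (S \<union> T) \<in> padd M (x S) (x T)"
    and "S \<subseteq> {1..n} \<Longrightarrow> x S \<in> elts M"
  using assms by (auto simp: Hhat_set_def)

lemma Hhat_pset_simps [simp]:
  "pcarrier (Hhat_pset M n) = Hhat_set M n"
  "base (Hhat_pset M n) = (\<lambda>S \<in> Pow {1..n}. pzero M)"
  by (simp_all add: Hhat_pset_def)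

lemma base_in_Hhat_set: "is_plasma M \<Longrightarrow> (\<lambda>S \<in> Pow {1..n}. pzero M) \<in> Hhat_set M n"
  using is_plasmaD(2,3)[of M] by (auto simp: Hhat_set_def)

text \<open>The action of a pointed map \<open>\<phi> : {0..n} \<rightarrow> {0..m}\<close> on families.\<close>

definition reindex :: "nat \<Rightarrow> nat \<Rightarrow> (nat \<Rightarrow> nat) \<Rightarrow> (nat set \<Rightarrow> 'a) \<Rightarrow> nat set \<Rightarrow> 'a" where
  "reindex n m \<phi> x = (\<lambda>T \<in> Pow {1..m}. x {i \<in> {0..n}. \<phi> i \<in> T})"

text \<open>Preserving the base point means that the preimage of a set avoiding \<open>0\<close> avoids \<open>0\<close>, so taking
  preimages is a map between the index sets of families.\<close>

lemma preimage_subset: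
  "\<phi> 0 = 0 \<Longrightarrow> T \<subseteq> {1..m} \<Longrightarrow> {i \<in> {0..n}. \<phi> i \<in> T} \<subseteq> {1..n}" for \<phi> :: "nat \<Rightarrow> nat"
  by (auto intro!: Suc_leI gr0I)

lemma reindex_in_Hhat_set:
  assumes x: "x \<in> Hhat_set M n" and \<phi>: "\<phi> 0 = 0"
  shows "reindex n m \<phi> x \<in> Hhat_set M m"
proof -
  note x' = Hhat_setD[OF x]
  have "reindex n m \<phi> x (S \<union> T) \<in> padd M (reindex n m \<phi> x S) (reindex n m \<phi> x T)"
    if "S \<subseteq> {1..m}" "T \<subseteq> {1..m}" "S \<inter> T = {}" for S T
  proof -
    have "{i \<in> {0..n}. \<phi> i \<in> S \<union> T} = {i \<in> {0..n}. \<phi> i \<in> S} \<union> {i \<in> {0..n}. \<phi> i \<in> T}"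
      by auto
    then show ?thesis
      using that x'(3)[OF preimage_subset[of \<phi> S m n] preimage_subset[of \<phi> T m n]] \<phi>
      by (auto simp: reindex_def)
  qed
  moreover have "reindex n m \<phi> x \<in> Pow {1..m} \<rightarrow>\<^sub>E elts M"
    using x'(4) preimage_subset[of \<phi> _ m n] \<phi> by (auto simp: reindex_def)
  ultimately show ?thesis using x'(2) by (simp add: Hhat_set_def reindex_def)
qed

lemma omap_Hhat_module [simp]: "omap (Hhat_module M) = Hhat_pset M"
  by (simp add: Hhat_module_def)

lemma amap_Hhat_module:
  "\<phi> \<in> hom Fin_pt n m \<Longrightarrow> amap (Hhat_module M) \<phi> =
     Arrow (Hhat_pset M n) (Hhat_pset M m) (\<lambda>x \<in> Hhat_set M n. reindex n m (mapping \<phi>) x)"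
  by (auto simp: Hhat_module_def in_hom_iff Fin_pt_def reindex_def)

lemma reindex_ident:
  assumes "x \<in> Hhat_set M n"
  shows "reindex n n (\<lambda>i \<in> {0..n}. i) x = x"
proof (rule extensionalityI[of _ "Pow {1..n}"])
  fix S assume "S \<in> Pow {1..n}"
  then have "{i \<in> {0..n}. (\<lambda>i \<in> {0..n}. i) i \<in> S} = S" by fastforce
  then show "reindex n n (\<lambda>i \<in> {0..n}. i) x S = x S"
    using \<open>S \<in> Pow {1..n}\<close> by (simp only: reindex_def restrict_apply' if_True)
qed (use Hhat_setD(1)[OF assms] in \<open>auto simp: reindex_def PiE_iff\<close>)

lemma reindex_compose:
  assumes "\<phi> \<in> {0..n} \<rightarrow> {0..m}" "\<psi> 0 = 0"
  shows "reindex n k (compose {0..n} \<psi> \<phi>) x = reindex m k \<psi> (reindex n m \<phi> x)"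
proof (rule extensionalityI[of _ "Pow {1..k}"])
  fix T assume T: "T \<in> Pow {1..k}"
  have "{i \<in> {0..n}. compose {0..n} \<psi> \<phi> i \<in> T} = {i \<in> {0..n}. \<phi> i \<in> {j \<in> {0..m}. \<psi> j \<in> T}}"
    using assms(1) by (auto simp: compose_def Pi_iff)
  then show "reindex n k (compose {0..n} \<psi> \<phi>) x T = reindex m k \<psi> (reindex n m \<phi> x) T"
    using T preimage_subset[of \<psi> T k m] assms(2) by (simp add: reindex_def)
qed (auto simp: reindex_def)

lemma is_functor_Hhat_module:
  assumes M: "is_plasma M"
  shows "is_functor Fin_pt Set_pt (Hhat_module M)"
proof (rule functorI)
  show "is_category Fin_pt" "is_category Set_pt" by (rule is_category_Fin_pt is_category_Set_pt)+
  show "omap (Hhat_module M) \<in> extensional (obj Fin_pt)" by (simp add: Fin_pt_def)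
  show "amap (Hhat_module M) \<in> extensional (arr Fin_pt)" by (simp add: Hhat_module_def)
  fix n assume n: "n \<in> obj Fin_pt"
  show "omap (Hhat_module M) n \<in> obj Set_pt"
    using base_in_Hhat_set[OF M] by (simp add: Set_pt_def)
  have "ident Fin_pt n = Arrow n n (\<lambda>i \<in> {0..n}. i)" by (simp add: Fin_pt_def)
  then show "amap (Hhat_module M) (ident Fin_pt n) = ident Set_pt (omap (Hhat_module M) n)"
    using amap_Hhat_module[OF category_identI[OF is_category_Fin_pt n], of M]
    by (auto simp: Set_pt_def reindex_ident fun_eq_iff)
next
  fix \<phi> n m assume \<phi>: "\<phi> \<in> hom Fin_pt n m"
  have \<phi>0: "mapping \<phi> 0 = 0" using \<phi> by (simp add: hom_Fin_pt_iff)
  have base: "reindex n m (mapping \<phi>) (\<lambda>S \<in> Pow {1..n}. pzero M) = (\<lambda>S \<in> Pow {1..m}. pzero M)"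
    using preimage_subset[of "mapping \<phi>" _ m n] \<phi>0 by (auto simp: reindex_def fun_eq_iff)
  show "amap (Hhat_module M) \<phi> \<in> hom Set_pt (omap (Hhat_module M) n) (omap (Hhat_module M) m)"
    using base_in_Hhat_set[OF M] base reindex_in_Hhat_set[of _ M n "mapping \<phi>" m] \<phi>0
    by (simp add: hom_Set_pt_iff amap_Hhat_module[OF \<phi>])
  fix \<psi> k assume \<psi>: "\<psi> \<in> hom Fin_pt m k"
  have "mapping (cmp Fin_pt \<psi> \<phi>) = compose {0..n} (mapping \<psi>) (mapping \<phi>)"
    using \<phi> by (simp add: Fin_pt_def in_hom_iff)
  moreover have "reindex n k (compose {0..n} (mapping \<psi>) (mapping \<phi>)) x =
      reindex m k (mapping \<psi>) (reindex n m (mapping \<phi>) x)" for x :: "nat set \<Rightarrow> 'a"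
    using \<phi> \<psi> by (intro reindex_compose) (auto simp: hom_Fin_pt_iff)
  ultimately have "reindex n k (mapping (cmp Fin_pt \<psi> \<phi>)) x =
      reindex m k (mapping \<psi>) (reindex n m (mapping \<phi>) x)" for x :: "nat set \<Rightarrow> 'a"
    by simp
  then show "amap (Hhat_module M) (cmp Fin_pt \<psi> \<phi>) =
      cmp Set_pt (amap (Hhat_module M) \<psi>) (amap (Hhat_module M) \<phi>)"
    using reindex_in_Hhat_set[of _ M n "mapping \<phi>" m] \<phi>0
    by (auto simp: Set_pt_def amap_Hhat_module[OF \<phi>] amap_Hhat_module[OF \<psi>]
        amap_Hhat_module[OF category_cmpI[OF is_category_Fin_pt \<phi> \<psi>]] compose_def fun_eq_iff)
qed

text \<open>In degree 0 the only entry of a family is the one at \<open>{}\<close>, which is prescribed.\<close>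

lemma Hhat_module_in_Mod_F1:
  assumes M: "is_plasma M"
  shows "Hhat_module M \<in> obj Mod_F1"
proof -
  have "Hhat_set M 0 = {\<lambda>S \<in> Pow {1..0}. pzero M}"
    using base_in_Hhat_set[OF M, of 0]
    by (auto simp: Hhat_set_def PiE_iff intro!: extensionalityI[of _ "{{}}"])
  then show ?thesis
    using is_functor_Hhat_module[OF M] by (simp add: Mod_F1_def)
qed

lemma is_category_Mod_F1: "is_category Mod_F1"
  unfolding Mod_F1_def by (intro is_category_full_subcategory is_category_functor_category)

lemma hom_Mod_F1_iff:
  "X \<in> obj Mod_F1 \<Longrightarrow> Y \<in> obj Mod_F1 \<Longrightarrow> \<alpha> \<in> hom Mod_F1 X Y \<longleftrightarrow>
     source \<alpha> = X \<and> target \<alpha> = Y \<and> natural_transformation Fin_pt Set_pt X Y (mapping \<alpha>)"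
  by (auto simp: Mod_F1_def hom_full_subcategory_iff hom_functor_category_iff)

definition Hhat_component ::
  "'a plasma \<Rightarrow> 'a plasma \<Rightarrow> ('a \<Rightarrow> 'a) \<Rightarrow> nat \<Rightarrow>
     ((nat set \<Rightarrow> 'a) pset, (nat set \<Rightarrow> 'a) \<Rightarrow> (nat set \<Rightarrow> 'a)) arrow" where
  "Hhat_component M N f n = Arrow (Hhat_pset M n) (Hhat_pset N n)
     (\<lambda>x \<in> Hhat_set M n. \<lambda>S \<in> Pow {1..n}. f (x S))"

lemma amap_Hhat_functor:
  "f \<in> hom Plas M N \<Longrightarrow> amap Hhat_functor f =
     Arrow (Hhat_module M) (Hhat_module N) (Hhat_component M N (mapping f))"
  by (auto simp: Hhat_functor_def in_hom_iff Plas_def Hhat_component_def fun_eq_iff)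

lemma omap_Hhat_functor: "is_plasma M \<Longrightarrow> omap Hhat_functor M = Hhat_module M"
  by (simp add: Hhat_functor_def Plas_def)

lemma image_family_in_Hhat_set:
  assumes f: "f \<in> plasma_morphisms M N" and x: "x \<in> Hhat_set M n"
  shows "(\<lambda>S \<in> Pow {1..n}. f (x S)) \<in> Hhat_set N n"
  using plasma_morphismsD[OF f] Hhat_setD[OF x] by (auto simp: Hhat_set_def)

text \<open>Naturality holds because applying \<open>f\<close> to the entries commutes with reindexing them.\<close>

lemma natural_transformation_Hhat_component:
  assumes M: "is_plasma M" and N: "is_plasma N" and f: "f \<in> plasma_morphisms M N"
  shows "natural_transformation Fin_pt Set_pt (Hhat_module M) (Hhat_module N) (Hhat_component M N f)"
proof -
  have "cmp Set_pt (Hhat_component M N f m) (amap (Hhat_module M) \<phi>) =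
      cmp Set_pt (amap (Hhat_module N) \<phi>) (Hhat_component M N f n)"
    if \<phi>: "\<phi> \<in> hom Fin_pt n m" for \<phi> n m
  proof -
    have \<phi>0: "mapping \<phi> 0 = 0" using \<phi> by (simp add: hom_Fin_pt_iff)
    have "(\<lambda>T \<in> Pow {1..m}. f (reindex n m (mapping \<phi>) x T)) =
        reindex n m (mapping \<phi>) (\<lambda>S \<in> Pow {1..n}. f (x S))" for x
      using preimage_subset[of "mapping \<phi>" _ m n] \<phi>0 by (auto simp: reindex_def fun_eq_iff)
    then show ?thesis
      using reindex_in_Hhat_set[of _ M n "mapping \<phi>" m] \<phi>0 image_family_in_Hhat_set[OF f]
      by (auto simp: Set_pt_def amap_Hhat_module[OF \<phi>] Hhat_component_def compose_def fun_eq_iff)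
  qed
  moreover have "Hhat_component M N f n \<in> hom Set_pt (Hhat_pset M n) (Hhat_pset N n)" for n
    using base_in_Hhat_set[OF M] base_in_Hhat_set[OF N] image_family_in_Hhat_set[OF f]
      plasma_morphismsD(2)[OF f]
    by (auto simp: hom_Set_pt_iff Hhat_component_def fun_eq_iff)
  ultimately show ?thesis
    using is_functor_Hhat_module[OF M] is_functor_Hhat_module[OF N]
    by (auto simp: natural_transformation_def in_hom_iff Fin_pt_def)
qed

lemma is_functor_Hhat: "is_functor Plas Mod_F1 Hhat_functor"
proof (rule functorI)
  show "is_category Plas" "is_category Mod_F1" by (rule is_category_Plas is_category_Mod_F1)+
  show "omap Hhat_functor \<in> extensional (obj Plas)" "amap Hhat_functor \<in> extensional (arr Plas)"
    by (simp_all add: Hhat_functor_def)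
  fix M :: "'a plasma" assume M: "M \<in> obj Plas"
  then have M': "is_plasma M" by (simp add: Plas_def)
  then show "omap Hhat_functor M \<in> obj Mod_F1"
    by (simp add: omap_Hhat_functor Hhat_module_in_Mod_F1)
  have "Hhat_component M M (\<lambda>x \<in> elts M. x) n = ident Set_pt (Hhat_pset M n)" for n
  proof -
    have "(\<lambda>S \<in> Pow {1..n}. (\<lambda>x \<in> elts M. x) (x S)) = x" if "x \<in> Hhat_set M n" for x
      using Hhat_setD[OF that] by (auto intro!: extensionalityI[of _ "Pow {1..n}"] simp: PiE_iff)
    then show ?thesis by (auto simp: Set_pt_def Hhat_component_def fun_eq_iff)
  qed
  then show "amap Hhat_functor (ident Plas M) = ident Mod_F1 (omap Hhat_functor M)"
    using amap_Hhat_functor[OF category_identI[OF is_category_Plas M]] omap_Hhat_functor[OF M']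
    by (simp add: Plas_def Mod_F1_def Fin_pt_def fun_eq_iff)
next
  fix f :: "('a plasma, 'a \<Rightarrow> 'a) arrow" and M N assume f: "f \<in> hom Plas M N"
  then have f': "is_plasma M" "is_plasma N" "mapping f \<in> plasma_morphisms M N"
    by (auto simp: hom_Plas_iff)
  show "amap Hhat_functor f \<in> hom Mod_F1 (omap Hhat_functor M) (omap Hhat_functor N)"
    using f' natural_transformation_Hhat_component[OF f']
    by (simp add: amap_Hhat_functor[OF f] omap_Hhat_functor hom_Mod_F1_iff Hhat_module_in_Mod_F1)
  fix g K assume g: "g \<in> hom Plas N K"
  have "mapping (cmp Plas g f) = compose (elts M) (mapping g) (mapping f)"
    using f by (simp add: Plas_def in_hom_iff)
  moreover have "Hhat_component M K (compose (elts M) (mapping g) (mapping f)) n =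
      cmp Set_pt (Hhat_component N K (mapping g) n) (Hhat_component M N (mapping f) n)" for n
    using image_family_in_Hhat_set[OF f'(3)] Hhat_setD(4)[of _ M n]
    by (auto simp: Set_pt_def Hhat_component_def compose_def fun_eq_iff)
  ultimately have "Hhat_component M K (mapping (cmp Plas g f)) n =
      cmp Set_pt (Hhat_component N K (mapping g) n) (Hhat_component M N (mapping f) n)" for n
    by simp
  then show "amap Hhat_functor (cmp Plas g f) =
      cmp Mod_F1 (amap Hhat_functor g) (amap Hhat_functor f)"
    by (simp add: amap_Hhat_functor[OF f] amap_Hhat_functor[OF g] Mod_F1_def Fin_pt_def fun_eq_iff
        amap_Hhat_functor[OF category_cmpI[OF is_category_Plas f g]])
qed


section \<open>Full faithfulness of the module functor\<close>

definition point_family :: "'a plasma \<Rightarrow> 'a \<Rightarrow> nat set \<Rightarrow> 'a" where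
  "point_family M x = (\<lambda>S \<in> Pow {1..1}. if S = {} then pzero M else x)"

definition sum_family :: "'a plasma \<Rightarrow> 'a \<Rightarrow> 'a \<Rightarrow> 'a \<Rightarrow> nat set \<Rightarrow> 'a" where
  "sum_family M x y z = (\<lambda>S \<in> Pow {1..2}.
     if S = {} then pzero M else if S = {1} then x else if S = {2} then y else z)"

text \<open>The lower bound is written \<^term>\<open>Suc 0\<close>, the form into which the simplifier brings it.\<close>

lemma subset_1_cases: "S \<subseteq> {Suc 0..Suc 0} \<longleftrightarrow> S = {} \<or> S = {1}"
  by (simp add: subset_singleton_iff)

lemma subset_2_cases: "S \<subseteq> {Suc 0..2} \<longleftrightarrow> S = {} \<or> S = {1} \<or> S = {2} \<or> S = {1, 2}"
proof -
  have "S \<subseteq> {Suc 0..2} \<longleftrightarrow> S \<in> Pow {1, 2}"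
    by (simp add: atLeastAtMost_insertL [symmetric] numeral_2_eq_2)
  also have "\<dots> \<longleftrightarrow> S = {} \<or> S = {1} \<or> S = {2} \<or> S = {1, 2}"
    by (simp only: Pow_insert Pow_empty image_insert image_empty insert_iff Un_iff empty_iff) auto
  finally show ?thesis .
qed

lemma disjoint_nonempty_subsets_2:
  assumes "S \<subseteq> {Suc 0..2}" "T \<subseteq> {Suc 0..2}" "S \<inter> T = {}" "S \<noteq> {}" "T \<noteq> {}"
  shows "S = {1} \<and> T = {2} \<or> S = {2} \<and> T = {1}"
proof -
  have "S \<in> {{1}, {2}, {1, 2}}" "T \<in> {{1}, {2}, {1, 2}}"
    using assms subset_2_cases[of S] subset_2_cases[of T] by simp_all
  then show ?thesis using assms(3) by (elim insertE emptyE) simp_all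
qed

text \<open>The conditions with an empty part hold automatically, since they only say that \<open>0\<close> is neutral in
  the weak sense of a plasma.\<close>

lemma Hhat_setI:
  assumes M: "is_plasma M" and x: "x \<in> Pow {1..n} \<rightarrow>\<^sub>E elts M" "x {} = pzero M"
    and add: "\<And>S T. S \<subseteq> {1..n} \<Longrightarrow> T \<subseteq> {1..n} \<Longrightarrow> S \<inter> T = {} \<Longrightarrow> S \<noteq> {} \<Longrightarrow> T \<noteq> {}
      \<Longrightarrow> x (S \<union> T) \<in> padd M (x S) (x T)"
  shows "x \<in> Hhat_set M n"
proof -
  have "x (S \<union> T) \<in> padd M (x S) (x T)"
    if ST: "S \<subseteq> {1..n}" "T \<subseteq> {1..n}" "S \<inter> T = {}" for S T
  proof -
    have mem: "x S \<in> elts M" "x T \<in> elts M" using x(1) ST by auto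
    consider "S = {}" | "T = {}" | "S \<noteq> {}" "T \<noteq> {}" by blast
    then show ?thesis
      using add[OF ST] is_plasmaD(3)[OF M mem(2)] is_plasmaD(4)[OF M mem(1)] x(2) by cases simp_all
  qed
  then show ?thesis using x by (simp add: Hhat_set_def)
qed

lemma point_family_in_Hhat_set:
  assumes M: "is_plasma M" and x: "x \<in> elts M"
  shows "point_family M x \<in> Hhat_set M 1"
proof (rule Hhat_setI[OF M])
  show "point_family M x \<in> Pow {1..1} \<rightarrow>\<^sub>E elts M" "point_family M x {} = pzero M"
    using is_plasmaD(2)[OF M] x by (simp_all add: point_family_def)
next
  fix S T :: "nat set"
  assume ST: "S \<subseteq> {1..1}" "T \<subseteq> {1..1}" "S \<inter> T = {}" "S \<noteq> {}" "T \<noteq> {}"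
  then have "S = {1}" "T = {1}" using subset_1_cases by simp_all
  with ST(3) show "point_family M x (S \<union> T) \<in> padd M (point_family M x S) (point_family M x T)"
    by simp
qed

lemma sum_family_in_Hhat_set:
  assumes M: "is_plasma M" and x: "x \<in> elts M" and y: "y \<in> elts M" and z: "z \<in> padd M x y"
  shows "sum_family M x y z \<in> Hhat_set M 2"
proof (rule Hhat_setI[OF M])
  show "sum_family M x y z \<in> Pow {1..2} \<rightarrow>\<^sub>E elts M" "sum_family M x y z {} = pzero M"
    using x y subsetD[OF is_plasmaD(1)[OF M x y] z] is_plasmaD(2)[OF M]
    unfolding sum_family_def by simp_all
next
  fix S T :: "nat set"
  assume "S \<subseteq> {1..2}" "T \<subseteq> {1..2}" "S \<inter> T = {}" "S \<noteq> {}" "T \<noteq> {}"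
  then have ST: "S = {1} \<and> T = {2} \<or> S = {2} \<and> T = {1}"
    by (intro disjoint_nonempty_subsets_2) simp_all
  have z': "z \<in> padd M y x" using z by (simp only: is_plasmaD(5)[OF M y x])
  have vals: "sum_family M x y z {1} = x" "sum_family M x y z {2} = y"
    "sum_family M x y z ({1} \<union> {2}) = z" "sum_family M x y z ({2} \<union> {1}) = z"
    by (simp_all add: sum_family_def)
  from ST show "sum_family M x y z (S \<union> T) \<in> padd M (sum_family M x y z S) (sum_family M x y z T)"
  proof (elim disjE conjE)
    assume "S = {1}" "T = {2}"
    then show ?thesis by (simp only: vals z)
  next
    assume "S = {2}" "T = {1}"
    then show ?thesis by (simp only: vals z')
  qed
qed

text \<open>Two morphisms inducing the same map in degree 1 agree, as every element is an entry of a family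
  there.\<close>

lemma faithful_Hhat: "faithful_functor Plas Mod_F1 Hhat_functor"
  unfolding faithful_functor_def
proof (intro conjI ballI is_functor_Hhat inj_onI)
  fix M N :: "'a plasma" and f g
  assume f: "f \<in> hom Plas M N" and g: "g \<in> hom Plas M N"
    and eq: "amap Hhat_functor f = amap Hhat_functor g"
  have M: "is_plasma M" using f by (simp add: hom_Plas_iff)
  have "mapping f x = mapping g x" if x: "x \<in> elts M" for x
  proof -
    have "mapping (Hhat_component M N (mapping f) 1) (point_family M x) {1} =
        mapping (Hhat_component M N (mapping g) 1) (point_family M x) {1}"
      using eq by (simp add: amap_Hhat_functor[OF f] amap_Hhat_functor[OF g])
    then show ?thesis
      using point_family_in_Hhat_set[OF M x] by (simp add: Hhat_component_def point_family_def)
  qed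
  moreover have "mapping f \<in> extensional (elts M)" "mapping g \<in> extensional (elts M)"
    using f g plasma_morphismsD(1) by (force simp: hom_Plas_iff PiE_iff)+
  ultimately have "mapping f = mapping g" by (intro extensionalityI)
  then show "f = g" using f g by (auto simp: hom_Plas_iff intro: arrow_eqI)
qed

definition indicator_arrow :: "nat \<Rightarrow> nat set \<Rightarrow> (nat, nat \<Rightarrow> nat) arrow" where
  "indicator_arrow n S = Arrow n 1 (\<lambda>i \<in> {0..n}. if i \<in> S then 1 else 0)"

lemma indicator_arrow_in_hom: "S \<subseteq> {1..n} \<Longrightarrow> indicator_arrow n S \<in> hom Fin_pt n 1"
  by (auto simp: hom_Fin_pt_iff indicator_arrow_def)

text \<open>The preimage of \<open>{1}\<close> under the indicator map is \<open>S\<close>, so this map extracts the entry at \<open>S\<close> and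
  turns it into a family in degree 1.\<close>

lemma reindex_indicator:
  assumes S: "S \<subseteq> {1..n}" and x: "x \<in> Hhat_set M n"
  shows "reindex n 1 (mapping (indicator_arrow n S)) x = point_family M (x S)"
proof (rule extensionalityI[of _ "Pow {1..1}"])
  fix T :: "nat set" assume "T \<in> Pow {1..1}"
  then consider "T = {}" | "T = {1}" using subset_1_cases by auto
  then show "reindex n 1 (mapping (indicator_arrow n S)) x T = point_family M (x S) T"
  proof cases
    case 1
    then show ?thesis using Hhat_setD(2)[OF x] by (simp add: reindex_def point_family_def)
  next
    case 2
    have "{i \<in> {0..n}. mapping (indicator_arrow n S) i \<in> {1}} = S"
      using S by (auto simp: indicator_arrow_def split: if_splits)
    then show ?thesis using 2 by (simp add: reindex_def point_family_def)
  qed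
qed (simp_all add: reindex_def point_family_def)

text \<open>The candidate \<open>f\<close> is the transformation in degree 1.  Naturality along indicator maps shows that
  the transformation applies \<open>f\<close> entrywise in every degree, and degree 2 shows that \<open>f\<close> respects
  \<open>\<boxplus>\<close>.\<close>

lemma natural_transformation_is_Hhat_component:
  assumes M: "is_plasma M" and N: "is_plasma N"
    and \<eta>: "natural_transformation Fin_pt Set_pt (Hhat_module M) (Hhat_module N) \<eta>"
  shows "\<exists>f \<in> plasma_morphisms M N. \<eta> = Hhat_component M N f"
proof -
  have hom: "\<eta> n \<in> hom Set_pt (Hhat_pset M n) (Hhat_pset N n)" for n
    using natural_transformationD(4)[OF \<eta>, of n] by (simp add: Fin_pt_def)
  have maps: "mapping (\<eta> n) x \<in> Hhat_set N n" if "x \<in> Hhat_set M n" for n x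
    using hom[of n] that by (auto simp: hom_Set_pt_iff)
  define f where "f = (\<lambda>a \<in> elts M. mapping (\<eta> 1) (point_family M a) {1})"
  have eta: "mapping (\<eta> n) x S = f (x S)" if x: "x \<in> Hhat_set M n" and S: "S \<subseteq> {1..n}" for n x S
  proof -
    let ?\<phi> = "indicator_arrow n S"
    have "mapping (cmp Set_pt (\<eta> 1) (amap (Hhat_module M) ?\<phi>)) x =
        mapping (cmp Set_pt (amap (Hhat_module N) ?\<phi>) (\<eta> n)) x"
      using natural_transformationD(5)[OF \<eta> indicator_arrow_in_hom[OF S]] by simp
    then have "mapping (\<eta> 1) (reindex n 1 (mapping ?\<phi>) x) =
        reindex n 1 (mapping ?\<phi>) (mapping (\<eta> n) x)"
      using hom[of n] x maps[OF x]
      by (simp add: Set_pt_def amap_Hhat_module[OF indicator_arrow_in_hom[OF S]] compose_def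
          hom_concrete_category_iff)
    then have "mapping (\<eta> 1) (point_family M (x S)) = point_family N (mapping (\<eta> n) x S)"
      by (simp only: reindex_indicator[OF S x] reindex_indicator[OF S maps[OF x]])
    then have "mapping (\<eta> 1) (point_family M (x S)) {1} = mapping (\<eta> n) x S"
      by (simp add: point_family_def)
    then show ?thesis using Hhat_setD(4)[OF x S] by (simp add: f_def)
  qed
  have add: "f c \<in> padd N (f a) (f b)"
    if ab: "a \<in> elts M" "b \<in> elts M" and c: "c \<in> padd M a b" for a b c
  proof -
    note w = sum_family_in_Hhat_set[OF M ab c]
    have [simp]: "{1, 2} \<subseteq> {1..2::nat}" by auto
    have "{1} \<union> {2} = {1, 2::nat}" by auto
    then have "mapping (\<eta> 2) (sum_family M a b c) {1, 2} \<in>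
        padd N (mapping (\<eta> 2) (sum_family M a b c) {1}) (mapping (\<eta> 2) (sum_family M a b c) {2})"
      using Hhat_setD(3)[OF maps[OF w], of "{1}" "{2}"] by simp
    then show ?thesis
      by (simp add: eta[OF w]) (simp add: sum_family_def)
  qed
  have maps_f: "f a \<in> elts N" if "a \<in> elts M" for a
    using Hhat_setD(4)[OF maps[OF point_family_in_Hhat_set[OF M that]], of "{1}"] that
    by (simp add: f_def)
  have base_f: "f (pzero M) = pzero N"
    using eta[OF base_in_Hhat_set[OF M], of "{}" 0] Hhat_setD(2)[OF maps[OF base_in_Hhat_set[OF M]], of 0]
    by simp
  have "f \<in> extensional (elts M)" by (simp add: f_def)
  then have "f \<in> elts M \<rightarrow>\<^sub>E elts N" using maps_f by (simp add: PiE_iff)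
  then have "f \<in> plasma_morphisms M N"
    by (rule plasma_morphismsI) (fact base_f | erule (2) add)+
  moreover have "\<eta> n = Hhat_component M N f n" for n
  proof (rule arrow_eqI)
    show "mapping (\<eta> n) = mapping (Hhat_component M N f n)"
    proof (rule extensionalityI[of _ "Hhat_set M n"])
      fix x assume x: "x \<in> Hhat_set M n"
      have "mapping (\<eta> n) x = (\<lambda>S \<in> Pow {1..n}. f (x S))"
        using Hhat_setD(1)[OF maps[OF x]] eta[OF x]
        by (intro extensionalityI[of _ "Pow {1..n}"]) (auto simp: PiE_iff)
      then show "mapping (\<eta> n) x = mapping (Hhat_component M N f n) x"
        using x by (simp add: Hhat_component_def)
    qed (use hom[of n] in \<open>auto simp: hom_Set_pt_iff Hhat_component_def PiE_iff\<close>)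
  qed (use hom[of n] in \<open>auto simp: hom_Set_pt_iff Hhat_component_def\<close>)
  ultimately show ?thesis by blast
qed

lemma full_Hhat: "full_functor Plas Mod_F1 Hhat_functor"
  unfolding full_functor_def
proof (intro conjI ballI is_functor_Hhat equalityI subsetI)
  fix M N :: "'a plasma" and \<alpha>
  assume "\<alpha> \<in> amap Hhat_functor ` hom Plas M N"
  then show "\<alpha> \<in> hom Mod_F1 (omap Hhat_functor M) (omap Hhat_functor N)"
    using functorD(5)[OF is_functor_Hhat] by blast
next
  fix M N :: "'a plasma" and \<alpha>
  assume "M \<in> obj Plas" "N \<in> obj Plas"
    and \<alpha>: "\<alpha> \<in> hom Mod_F1 (omap Hhat_functor M) (omap Hhat_functor N)"
  then have M: "is_plasma M" and N: "is_plasma N" by (auto simp: Plas_def)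
  have \<alpha>': "source \<alpha> = Hhat_module M" "target \<alpha> = Hhat_module N"
    "natural_transformation Fin_pt Set_pt (Hhat_module M) (Hhat_module N) (mapping \<alpha>)"
    using \<alpha> by (auto simp: omap_Hhat_functor M N hom_Mod_F1_iff Hhat_module_in_Mod_F1)
  obtain f where f: "f \<in> plasma_morphisms M N" "mapping \<alpha> = Hhat_component M N f"
    using natural_transformation_is_Hhat_component[OF M N \<alpha>'(3)] by blast
  have hom: "Arrow M N f \<in> hom Plas M N" using M N f(1) by (simp add: hom_Plas_iff)
  have "\<alpha> = amap Hhat_functor (Arrow M N f)"
    unfolding amap_Hhat_functor[OF hom] by (rule arrow_eqI) (simp_all add: \<alpha>' f(2))
  then show "\<alpha> \<in> amap Hhat_functor ` hom Plas M N" using hom by blast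
qed


section \<open>The composite functor\<close>

theorem theorem3p20:
  shows "faithful_functor (sMat :: ('a pointed_matroid, ('a pointed_matroid, 'a \<Rightarrow> 'a) arrow) category)
           Mod_F1 (comp_functor sMat Hhat_functor Pi_functor)
       \<and> fully_faithful_functor (Proj :: ('a pointed_matroid, ('a pointed_matroid, 'a \<Rightarrow> 'a) arrow) category)
           Mod_F1 (restrict_functor (comp_functor sMat Hhat_functor Pi_functor) Proj)"
proof -
  have faithful: "faithful_functor sMat Mod_F1 (comp_functor sMat Hhat_functor Pi_functor)"
    by (rule faithful_comp_functor[OF faithful_Pi faithful_Hhat])
  moreover have "faithful_functor Proj Mod_F1
      (restrict_functor (comp_functor sMat Hhat_functor Pi_functor) Proj)"
    unfolding Proj_def by (rule faithful_restrict_functor[OF faithful])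
  moreover have "full_functor Proj Mod_F1
      (restrict_functor (comp_functor sMat Hhat_functor Pi_functor) Proj)"
    using full_comp_functor[OF full_Pi_on_Proj full_Hhat]
    by (simp add: Proj_def restrict_comp_functor)
  ultimately show ?thesis by (simp add: fully_faithful_functor_def)
qed

end
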